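(* Consider the special case of the ordered unrelated machines scheduling problem with machines $1,\dots,c$ in which each job $j$ is described by loads $l_j\le h_j$ and an index $x_j\in\{1,\dots,c+1\}$, such that job $j$ has running time $l_j$ on machines $i<x_j$ and running time $h_j$ on machines $i\ge x_j$, and in which the sets $L=\{l_j\}$ and $H=\{h_j\}$ have size bounded by a constant. There is a polynomial-time algorithm that computes an assignment of the jobs to the machines minimizing the makespan.
   Context: In scheduling, an assignment maps each job to a machine; the makespan is the maximum over machines of the sum of running times of the jobs assigned to it. *)

theory Defs
  imports
    Complex_Main
    "HOL-Library.Log_Nat"
    "HOL-Computational_Algebra.Polynomial"
begin

section \<open>Scheduling on ordered unrelated machines\<close>

text \<open>
  An instance has machines \<open>1, \<dots>, c\<close> and jobs \<open>0, \<dots>, n - 1\<close>; \<open>t i j\<close> is the running time of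
  job \<open>j\<close> on machine \<open>i\<close>.  The machines are ordered: no job runs faster on a later machine.
\<close>

definition ordered_unrelated :: "nat \<Rightarrow> nat \<Rightarrow> (nat \<Rightarrow> nat \<Rightarrow> rat) \<Rightarrow> bool" where
  "ordered_unrelated c n t \<longleftrightarrow>
     1 \<le> c \<and>
     (\<forall>j<n. \<forall>i\<in>{1..c}. 0 \<le> t i j) \<and>
     (\<forall>j<n. \<forall>i\<in>{1..c}. \<forall>i'\<in>{1..c}. i \<le> i' \<longrightarrow> t i j \<le> t i' j)"

definition is_assignment :: "nat \<Rightarrow> nat \<Rightarrow> (nat \<Rightarrow> nat) \<Rightarrow> bool" where
  "is_assignment c n a \<longleftrightarrow> (\<forall>j<n. a j \<in> {1..c})"

definition makespan :: "nat \<Rightarrow> nat \<Rightarrow> (nat \<Rightarrow> nat \<Rightarrow> rat) \<Rightarrow> (nat \<Rightarrow> nat) \<Rightarrow> rat" where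
  "makespan c n t a = (MAX i\<in>{1..c}. \<Sum>j\<in>{j. j < n \<and> a j = i}. t i j)"

definition optimal_assignment :: "nat \<Rightarrow> nat \<Rightarrow> (nat \<Rightarrow> nat \<Rightarrow> rat) \<Rightarrow> (nat \<Rightarrow> nat) \<Rightarrow> bool" where
  "optimal_assignment c n t a \<longleftrightarrow>
     is_assignment c n a \<and>
     (\<forall>b. is_assignment c n b \<longrightarrow> makespan c n t a \<le> makespan c n t b)"


section \<open>The special case of two loads per job\<close>

record job =
  low :: rat
  high :: rat
  idx :: nat

record inst =
  machines :: nat
  jobs :: "job list"

definition valid_job :: "nat \<Rightarrow> job \<Rightarrow> bool" where
  "valid_job c q \<longleftrightarrow> 0 \<le> low q \<and> low q \<le> high q \<and> idx q \<in> {1..c + 1}"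

definition valid_inst :: "inst \<Rightarrow> bool" where
  "valid_inst I \<longleftrightarrow> 1 \<le> machines I \<and> (\<forall>q\<in>set (jobs I). valid_job (machines I) q)"

definition run_time :: "inst \<Rightarrow> nat \<Rightarrow> nat \<Rightarrow> rat" where
  "run_time I i j =
     (let q = jobs I ! j in if i < idx q then low q else high q)"

definition low_loads :: "inst \<Rightarrow> rat set" where
  "low_loads I = low ` set (jobs I)"

definition high_loads :: "inst \<Rightarrow> rat set" where
  "high_loads I = high ` set (jobs I)"

lemma valid_inst_ordered_unrelated:
  assumes "valid_inst I"
  shows "ordered_unrelated (machines I) (length (jobs I)) (run_time I)"
proof -
  have "valid_job (machines I) (jobs I ! j)" if "j < length (jobs I)" for j
    using assms that by (simp add: valid_inst_def)
  then show ?thesis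
    using assms
    by (auto simp: valid_inst_def valid_job_def ordered_unrelated_def run_time_def Let_def
        intro: order_trans)
qed


section \<open>Algorithms and their running time\<close>

text \<open>
  The machine model is a logarithmic-cost random access machine with structured control flow.  The
  memory consists of arrays of unbounded natural numbers; a program mentions finitely many array
  names, and a scalar variable is cell 0 of an array.  Every value that is computed, including
  every array index and every constant, is charged its binary length, so that the total cost
  is polynomially related to the running time of a Turing machine.
\<close>

type_synonym name = string
type_synonym state = "name \<Rightarrow> nat \<Rightarrow> nat"

datatype bop = Add | Sub | Mul | Div | Less

datatype expr =
    Const nat
  | Load name expr
  | Bin bop expr expr

datatype com =
    Skip
  | Store name expr expr
  | Seq com com
  | Cond expr com com
  | While expr com

text \<open>Binary length plus one, so that the number 0 is not free of charge.\<close>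

definition bits :: "nat \<Rightarrow> nat" where
  "bits v = Suc (floorlog 2 v)"

fun apply_bop :: "bop \<Rightarrow> nat \<Rightarrow> nat \<Rightarrow> nat" where
  "apply_bop Add v w = v + w"
| "apply_bop Sub v w = v - w"
| "apply_bop Mul v w = v * w"
| "apply_bop Div v w = v div w"
| "apply_bop Less v w = (if v < w then 1 else 0)"

fun expr_val :: "expr \<Rightarrow> state \<Rightarrow> nat" where
  "expr_val (Const v) s = v"
| "expr_val (Load a e) s = s a (expr_val e s)"
| "expr_val (Bin f e e') s = apply_bop f (expr_val e s) (expr_val e' s)"

fun expr_cost :: "expr \<Rightarrow> state \<Rightarrow> nat" where
  "expr_cost (Const v) s = bits v"
| "expr_cost (Load a e) s = expr_cost e s + bits (expr_val (Load a e) s)"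
| "expr_cost (Bin f e e') s =
     expr_cost e s + expr_cost e' s + bits (expr_val (Bin f e e') s)"

text \<open>\<open>exec p s t s'\<close>: program \<open>p\<close>, started in \<open>s\<close>, halts in \<open>s'\<close> at total cost \<open>t\<close>.
  A condition counts as true if its value is not 0.\<close>

inductive exec :: "com \<Rightarrow> state \<Rightarrow> nat \<Rightarrow> state \<Rightarrow> bool" where
  Skip: "exec Skip s 1 s"
| Store: "exec (Store a e e') s (expr_cost e s + expr_cost e' s + 1)
            (s(a := (s a)(expr_val e s := expr_val e' s)))"
| Seq: "exec p s t s' \<Longrightarrow> exec q s' t' s'' \<Longrightarrow> exec (Seq p q) s (t + t' + 1) s''"
| Cond_True: "expr_val e s \<noteq> 0 \<Longrightarrow> exec p s t s' \<Longrightarrow>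
     exec (Cond e p q) s (expr_cost e s + t + 1) s'"
| Cond_False: "expr_val e s = 0 \<Longrightarrow> exec q s t s' \<Longrightarrow>
     exec (Cond e p q) s (expr_cost e s + t + 1) s'"
| While_True: "expr_val e s \<noteq> 0 \<Longrightarrow> exec p s t s' \<Longrightarrow> exec (While e p) s' t' s'' \<Longrightarrow>
     exec (While e p) s (expr_cost e s + t + t' + 1) s''"
| While_False: "expr_val e s = 0 \<Longrightarrow> exec (While e p) s (expr_cost e s + 1) s"

inductive_cases exec_SkipE: "exec Skip s t s'"
inductive_cases exec_StoreE: "exec (Store a e e') s t s'"
inductive_cases exec_SeqE: "exec (Seq p q) s t s'"
inductive_cases exec_CondE: "exec (Cond e p q) s t s'"
inductive_cases exec_WhileE: "exec (While e p) s t s'"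

lemma exec_deterministic:
  assumes "exec p s t s'" and "exec p s u s''"
  shows "u = t \<and> s'' = s'"
  using assms
proof (induction p s t s' arbitrary: u s'' rule: exec.induct)
  case (Skip s)
  from Skip.prems show ?case by (rule exec_SkipE) simp
next
  case (Store a e e' s)
  from Store.prems show ?case by (rule exec_StoreE) simp
next
  case (Seq p s t s' q t' s1)
  from Seq.prems obtain v w s2
    where *: "exec p s v s2" "exec q s2 w s''" "u = Suc (v + w)"
    by (rule exec_SeqE)
  from Seq.IH(1) [OF *(1)] have "v = t" "s2 = s'" by simp_all
  with Seq.IH(2) * show ?case by simp
next
  case (Cond_True e s p t s' q)
  from Cond_True.prems obtain v
    where *: "exec p s v s''" "u = Suc (expr_cost e s + v)"
    by (rule exec_CondE) (use Cond_True.hyps(1) in auto)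
  from Cond_True.IH [OF *(1)] *(2) show ?case by simp
next
  case (Cond_False e s q t s' p)
  from Cond_False.prems obtain v
    where *: "exec q s v s''" "u = Suc (expr_cost e s + v)"
    by (rule exec_CondE) (use Cond_False.hyps(1) in auto)
  from Cond_False.IH [OF *(1)] *(2) show ?case by simp
next
  case (While_True e s p t s' t' s1)
  from While_True.prems obtain v w s2
    where *: "exec p s v s2" "exec (While e p) s2 w s''" "u = Suc (expr_cost e s + v + w)"
    by (rule exec_WhileE) (use While_True.hyps(1) in auto)
  from While_True.IH(1) [OF *(1)] have "v = t" "s2 = s'" by simp_all
  with While_True.IH(2) * show ?case by simp
next
  case (While_False e s p)
  from While_False.prems show ?case
    by (rule exec_WhileE) (use While_False.hyps in simp_all)
qed


section \<open>Input and output\<close>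

text \<open>A nonnegative rational is given by its numerator and denominator in lowest terms.\<close>

definition encode_rat :: "rat \<Rightarrow> nat list" where
  "encode_rat r = [nat (fst (quotient_of r)), nat (snd (quotient_of r))]"

definition encode_job :: "job \<Rightarrow> nat list" where
  "encode_job q = encode_rat (low q) @ encode_rat (high q) @ [idx q]"

definition encode :: "inst \<Rightarrow> nat list" where
  "encode I = machines I # length (jobs I) # concat (map encode_job (jobs I))"

text \<open>
  As usual for unrelated machines, the machines are listed in the input, so that polynomial time
  means polynomial in the number of machines, the number of jobs, and the binary length of the
  numbers.
\<close>

definition input_size :: "inst \<Rightarrow> nat" where
  "input_size I = machines I + sum_list (map bits (encode I))"

definition initial_state :: "inst \<Rightarrow> state" where
  "initial_state I =
     (\<lambda>a i. if a = ''in'' \<and> i < length (encode I) then encode I ! i else 0)"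

definition computed_assignment :: "state \<Rightarrow> nat \<Rightarrow> nat" where
  "computed_assignment s j = s ''out'' j"

end

(* Scaling by a common denominator makes all loads natural numbers.  Call a pair of loads a type;
   there are at most k^2 of them.  Sort the jobs of each type by x.  If m jobs of a type run high
   in some schedule, then one may assume that these are the m first ones and that the machines
   1, ..., i together run an interval of the sorted order, which grows upwards by low jobs and
   downwards by high jobs.  Hence a state after machine i consists of two numbers per type, there
   are at most (n + 1)^(2 k^2) states, and a minimax path through them with one step per machine,
   found by dynamic programming, yields an optimal schedule.  A path that is not of the special
   form does no harm: machine i is charged the true running time of every newly covered job. *)

theory Submission
  imports Defs
begin

section \<open>Resource-bounded weakest preconditions\<close>

text \<open>The program does not mention \<open>k\<close>: it discovers the types itself, and
  \<open>k\<close> enters only the polynomial bounding its cost. No exchange of jobs is carried out;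
  two inequalities suffice. Every assignment yields a path of states whose weights do not exceed its
  loads, by counting the jobs of each type that run low and high on the first machines. Conversely,
  every path from the empty to the full state yields an assignment whose loads do not exceed the
  weights, since each job goes to a machine on which it becomes covered. One number codes a state,
  so that the table is an ordinary array; the lower end of each interval is stored as its complement
  to n, which makes 0 the empty and N - 1 the full state. Since costs are logarithmic, the lengths
  of all intermediate numbers need bounds too.\<close>

fun deg :: "expr \<Rightarrow> nat" where
  "deg (Const v) = Suc v"
| "deg (Load a e) = 1"
| "deg (Bin f e e') = deg e + deg e'"

fun cost_coeff :: "expr \<Rightarrow> nat" where
  "cost_coeff (Const v) = 3 * Suc v"
| "cost_coeff (Load a e) = cost_coeff e + 3"
| "cost_coeff (Bin f e e') = cost_coeff e + cost_coeff e' + 3 * (deg e + deg e')"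

lemma deg_pos: "1 \<le> deg e"
  by (induction e) auto

text \<open>Both operand bounds are at least 2 by \<open>deg_pos\<close>, so their product dominates
  the result of each operation, and degrees add. A load has degree 1 whatever its index, since all
  cells obey the same bound.\<close>

lemma expr_val_le:
  assumes "1 \<le> m" and "\<forall>a i. s a i \<le> 2 ^ m"
  shows "expr_val e s \<le> 2 ^ (m * deg e)"
proof (induction e)
  case (Const v)
  have "v \<le> 2 ^ v" by (simp add: less_imp_le)
  also have "\<dots> \<le> 2 ^ (m * Suc v)" using assms(1) by (intro power_increasing) (auto simp: trans_le_add2)
  finally show ?case by simp
next
  case (Load a e)
  show ?case using assms(2) by simp
next
  case (Bin f e e')
  let ?v = "expr_val e s" and ?w = "expr_val e' s"
  let ?A = "2 ^ (m * deg e) :: nat" and ?B = "2 ^ (m * deg e') :: nat"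
  have two: "2 \<le> ?A" "2 \<le> ?B"
    using power_increasing [of 1 "m * deg e" "2::nat"] power_increasing [of 1 "m * deg e'" "2::nat"]
      assms(1) deg_pos [of e] deg_pos [of e'] by simp_all
  have AB: "2 ^ (m * deg (Bin f e e')) = ?A * ?B" by (simp add: power_add distrib_left)
  have "apply_bop f v w \<le> A * B" if "v \<le> A" "w \<le> B" "2 \<le> A" "2 \<le> B" for v w A B
  proof -
    have "A * 2 \<le> A * B" "2 * B \<le> A * B" using that by simp_all
    moreover have "v * w \<le> A * B" using that by (intro mult_le_mono)
    moreover have "v div w \<le> v" by (rule div_le_dividend)
    ultimately have "v + w \<le> A * B" "v - w \<le> A * B" "v * w \<le> A * B" "v div w \<le> A * B" "1 \<le> A * B"
      using that by linarith+
    then show ?thesis by (cases f) simp_all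
  qed
  with Bin.IH two show ?case unfolding AB expr_val.simps by blast
qed

text \<open>The length is at most \<open>q + 2\<close>, which \<open>1 \<le> q\<close> turns into
  the linear bound; this is the origin of the factor 3 in \<open>cost_coeff\<close>.\<close>

lemma bits_le:
  assumes "v \<le> 2 ^ q" and "1 \<le> q"
  shows "bits v \<le> 3 * q"
proof -
  have "floorlog 2 v \<le> floorlog 2 (2 ^ q)" using assms(1) by (rule floorlog_mono)
  also have "\<dots> = q + 1" using floorlog_power [of 2 1 q] by (simp add: floorlog_def)
  finally show ?thesis using assms(2) by (simp add: bits_def)
qed

lemma expr_cost_le:
  assumes "1 \<le> m" and "\<forall>a i. s a i \<le> 2 ^ m"
  shows "expr_cost e s \<le> m * cost_coeff e"
proof (induction e)
  case (Const v)
  have "bits v \<le> 3 * (m * deg (Const v))"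
    using expr_val_le [OF assms, of "Const v"] assms(1) by (intro bits_le) auto
  then show ?case by (simp add: algebra_simps)
next
  case (Load a e)
  have "bits (expr_val (Load a e) s) \<le> 3 * m"
    using assms by (intro bits_le) auto
  then show ?case using Load by (simp add: algebra_simps)
next
  case (Bin f e e')
  have "bits (expr_val (Bin f e e') s) \<le> 3 * (m * deg (Bin f e e'))"
    using expr_val_le [OF assms, of "Bin f e e'"] assms(1) deg_pos [of "Bin f e e'"]
    by (intro bits_le) auto
  then show ?case using Bin by (simp add: algebra_simps)
qed

text \<open>A weakest precondition that also bounds the resources: every loop runs for at most \<open>R\<close> iterations
  and every stored value is at most \<open>2 ^ m\<close>.  By \<open>wp_exec\<close> and \<open>cost_bound_poly\<close>, a program satisfying
  it with \<open>R\<close> and \<open>m\<close> polynomial in the input size runs in polynomial time, so that the correctness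
  proofs need not mention costs at all.\<close>

primrec wp :: "nat \<Rightarrow> nat \<Rightarrow> com \<Rightarrow> (state \<Rightarrow> bool) \<Rightarrow> state \<Rightarrow> bool" where
  "wp R m Skip = (\<lambda>Q s. Q s)"
| "wp R m (Store a e e') = (\<lambda>Q s. expr_val e' s \<le> 2 ^ m \<and>
     Q (s(a := (s a)(expr_val e s := expr_val e' s))))"
| "wp R m (Seq p q) = (\<lambda>Q. wp R m p (wp R m q Q))"
| "wp R m (Cond e p q) = (\<lambda>Q s. if expr_val e s \<noteq> 0 then wp R m p Q s else wp R m q Q s)"
| "wp R m (While e p) = (\<lambda>Q.
     ((\<lambda>X s. if expr_val e s \<noteq> 0 then wp R m p X s else Q s) ^^ R)
       (\<lambda>s. expr_val e s = 0 \<and> Q s))"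

text \<open>The branches of a conditional are added, not maximised, so that the bound is a
  polynomial in \<open>R\<close> and \<open>m\<close>, as \<open>cost_bound_poly\<close>
  requires.\<close>

primrec cost_bound :: "nat \<Rightarrow> nat \<Rightarrow> com \<Rightarrow> nat" where
  "cost_bound R m Skip = 1"
| "cost_bound R m (Store a e e') = m * (cost_coeff e + cost_coeff e') + 1"
| "cost_bound R m (Seq p q) = cost_bound R m p + cost_bound R m q + 1"
| "cost_bound R m (Cond e p q) =
     m * cost_coeff e + cost_bound R m p + cost_bound R m q + 1"
| "cost_bound R m (While e p) =
     (R + 1) * (m * cost_coeff e + cost_bound R m p + 1)"

primrec mods :: "com \<Rightarrow> name set" where
  "mods Skip = {}"
| "mods (Store a e e') = {a}"
| "mods (Seq p q) = mods p \<union> mods q"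
| "mods (Cond e p q) = mods p \<union> mods q"
| "mods (While e p) = mods p"

lemma wp_exec:
  assumes "1 \<le> m" and "\<forall>a i. s a i \<le> 2 ^ m" and "wp R m p Q s"
  shows "\<exists>t s'. exec p s t s' \<and> t \<le> cost_bound R m p \<and> Q s' \<and> (\<forall>a i. s' a i \<le> 2 ^ m)"
  using assms(2,3)
proof (induction p arbitrary: s Q)
  case Skip
  then show ?case by (intro exI [of _ 1] exI [of _ s]) (simp add: exec.Skip [simplified])
next
  case (Store a e e')
  have "expr_cost e s + expr_cost e' s + 1 \<le> cost_bound R m (Store a e e')"
    using expr_cost_le [OF assms(1) Store(1), of e] expr_cost_le [OF assms(1) Store(1), of e']
    by (simp add: distrib_left)
  moreover have "\<forall>b i. (s(a := (s a)(expr_val e s := expr_val e' s))) b i \<le> 2 ^ m"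
    using Store by simp
  moreover have "Q (s(a := (s a)(expr_val e s := expr_val e' s)))" using Store.prems(2) by simp
  ultimately show ?case using exec.Store [of a e e' s] by blast
next
  case (Seq p q)
  from Seq.IH(1) [OF Seq.prems(1)] Seq.prems(2) obtain t s1
    where 1: "exec p s t s1" "t \<le> cost_bound R m p" "wp R m q Q s1" "\<forall>a i. s1 a i \<le> 2 ^ m"
    by fastforce
  from Seq.IH(2) [OF 1(4,3)] obtain u s2
    where 2: "exec q s1 u s2" "u \<le> cost_bound R m q" "Q s2" "\<forall>a i. s2 a i \<le> 2 ^ m"
    by blast
  with 1 show ?case
    by (intro exI [of _ "t + u + 1"] exI [of _ s2]) (auto intro: exec.Seq [simplified])
next
  case (Cond e p q)
  have c: "expr_cost e s \<le> m * cost_coeff e" using expr_cost_le [OF assms(1) Cond.prems(1)] .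
  show ?case
  proof (cases "expr_val e s = 0")
    case True
    with Cond.IH(2) [OF Cond.prems(1)] Cond.prems(2) obtain u s2
      where 2: "exec q s u s2" "u \<le> cost_bound R m q" "Q s2" "\<forall>a i. s2 a i \<le> 2 ^ m"
      by fastforce
    with c exec.Cond_False [OF True 2(1)] show ?thesis
      by (intro exI [of _ "expr_cost e s + u + 1"] exI [of _ s2]) auto
  next
    case False
    with Cond.IH(1) [OF Cond.prems(1)] Cond.prems(2) obtain u s2
      where 2: "exec p s u s2" "u \<le> cost_bound R m p" "Q s2" "\<forall>a i. s2 a i \<le> 2 ^ m"
      by fastforce
    with c exec.Cond_True [OF False 2(1)] show ?thesis
      by (intro exI [of _ "expr_cost e s + u + 1"] exI [of _ s2]) auto
  qed
next
  case (While e p)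
  let ?F = "\<lambda>X s. if expr_val e s \<noteq> 0 then wp R m p X s else Q s"
  let ?I = "\<lambda>s. expr_val e s = 0 \<and> Q s"
  let ?K = "m * cost_coeff e + cost_bound R m p + 1"
  \<comment> \<open>The induction is on the iterations still allowed; the \<open>Suc\<close> pays
    for the final evaluation of the guard.\<close>
  have "\<exists>t s'. exec (While e p) s t s' \<and> t \<le> Suc r * ?K \<and> Q s' \<and> (\<forall>a i. s' a i \<le> 2 ^ m)"
    if "\<forall>a i. s a i \<le> 2 ^ m" "(?F ^^ r) ?I s" for r
    using that
  proof (induction r arbitrary: s)
    case 0
    then have "exec (While e p) s (expr_cost e s + 1) s" by (auto intro: exec.While_False [simplified])
    with 0 expr_cost_le [OF assms(1) 0(1), of e] show ?case
      by (intro exI [of _ "expr_cost e s + 1"] exI [of _ s]) auto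
  next
    case (Suc r)
    show ?case
    proof (cases "expr_val e s = 0")
      case True
      then have "exec (While e p) s (expr_cost e s + 1) s" by (auto intro: exec.While_False [simplified])
      with True Suc.prems expr_cost_le [OF assms(1) Suc.prems(1), of e] show ?thesis
        by (intro exI [of _ "expr_cost e s + 1"] exI [of _ s]) auto
    next
      case False
      with Suc.prems(2) have "wp R m p ((?F ^^ r) ?I) s" by simp
      from While.IH [OF Suc.prems(1) this] obtain t s1
        where 1: "exec p s t s1" "t \<le> cost_bound R m p" "(?F ^^ r) ?I s1" "\<forall>a i. s1 a i \<le> 2 ^ m"
        by blast
      from Suc.IH [OF 1(4,3)] obtain u s2
        where 2: "exec (While e p) s1 u s2" "u \<le> Suc r * ?K" "Q s2" "\<forall>a i. s2 a i \<le> 2 ^ m"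
        by blast
      from 1 2 expr_cost_le [OF assms(1) Suc.prems(1), of e] exec.While_True [OF False 1(1) 2(1)]
      show ?thesis
        by (intro exI [of _ "expr_cost e s + t + u + 1"] exI [of _ s2]) auto
    qed
  qed
  from this [OF While.prems(1), of R] While.prems(2) show ?case by auto
qed

lemma cost_bound_poly:
  fixes r q :: "nat poly"
  shows "\<exists>u :: nat poly. \<forall>S. cost_bound (poly r S) (poly q S) p = poly u S"
proof (induction p)
  case Skip
  show ?case by (rule exI [of _ 1]) simp
next
  case (Store a e e')
  show ?case by (rule exI [of _ "q * [:cost_coeff e + cost_coeff e':] + 1"]) simp
next
  case (Seq p p')
  then obtain u v where "\<forall>S. cost_bound (poly r S) (poly q S) p = poly u S"
    "\<forall>S. cost_bound (poly r S) (poly q S) p' = poly v S" by blast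
  then show ?case by (intro exI [of _ "u + v + 1"]) simp
next
  case (Cond e p p')
  then obtain u v where "\<forall>S. cost_bound (poly r S) (poly q S) p = poly u S"
    "\<forall>S. cost_bound (poly r S) (poly q S) p' = poly v S" by blast
  then show ?case by (intro exI [of _ "q * [:cost_coeff e:] + u + v + 1"]) simp
next
  case (While e p)
  then obtain u where "\<forall>S. cost_bound (poly r S) (poly q S) p = poly u S" by blast
  then show ?case by (intro exI [of _ "(r + 1) * (q * [:cost_coeff e:] + u + 1)"]) simp
qed

text \<open>Consequence and frame rule in one: the new postcondition may use that all arrays outside
  \<open>mods p\<close> are unchanged, which keeps intermediate assertions small.\<close>

lemma wp_mono:
  assumes "wp R m p Q s" and "\<And>s'. Q s' \<Longrightarrow> \<forall>a. a \<notin> mods p \<longrightarrow> s' a = s a \<Longrightarrow> Q' s'"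
  shows "wp R m p Q' s"
proof -
  \<comment> \<open>\<open>A\<close> stays fixed in the induction, so that all parts of the program
    share one frame and equalities chain through sequences and loops.\<close>
  have "wp R m p Q' s"
    if "wp R m p Q s" "mods p \<subseteq> A" "\<And>s'. Q s' \<Longrightarrow> \<forall>a. a \<notin> A \<longrightarrow> s' a = s a \<Longrightarrow> Q' s'" for A Q' Q s
    using that
  proof (induction p arbitrary: s Q Q')
    case (Seq p q)
    from Seq.prems(1) have "wp R m p (wp R m q Q) s" by simp
    then have "wp R m p (wp R m q Q') s"
    proof (rule Seq.IH(1))
      fix s1 assume 1: "wp R m q Q s1" "\<forall>a. a \<notin> A \<longrightarrow> s1 a = s a"
      show "wp R m q Q' s1"
        by (rule Seq.IH(2) [OF 1(1)]) (use 1 Seq.prems in auto)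
    qed (use Seq.prems in auto)
    then show ?case by simp
  next
    case (Cond e p q)
    then show ?case by (auto split: if_splits)
  next
    case (While e p)
    let ?F = "\<lambda>Q X s. if expr_val e s \<noteq> 0 then wp R m p X s else Q s"
    let ?I = "\<lambda>Q s. expr_val e s = 0 \<and> Q s"
    have "(?F Q' ^^ r) (?I Q') s1" if "(?F Q ^^ r) (?I Q) s1" "\<forall>a. a \<notin> A \<longrightarrow> s1 a = s a" for r s1
      using that
    proof (induction r arbitrary: s1)
      case 0
      then show ?case using While.prems(3) by simp
    next
      case (Suc r)
      show ?case
      proof (cases "expr_val e s1 = 0")
        case True
        then show ?thesis using Suc.prems While.prems(3) by simp
      next
        case False
        with Suc.prems(1) have "wp R m p ((?F Q ^^ r) (?I Q)) s1" by simp
        then have "wp R m p ((?F Q' ^^ r) (?I Q')) s1"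
          by (rule While.IH) (use Suc While.prems(2) in auto)
        with False show ?thesis by simp
      qed
    qed
    with While.prems(1) show ?case by auto
  qed auto
  from this [OF assms(1) subset_refl assms(2)] show ?thesis .
qed

section \<open>Counting loops\<close>

abbreviation Var :: "name \<Rightarrow> expr" where "Var a \<equiv> Load a (Const 0)"

definition For :: "name \<Rightarrow> name \<Rightarrow> com \<Rightarrow> com" where
  "For i b p = Seq (Store i (Const 0) (Const 0))
     (While (Bin Less (Var i) (Var b)) (Seq p (Store i (Const 0) (Bin Add (Var i) (Const 1)))))"

lemma mods_For [simp]: "mods (For i b p) = insert i (mods p)"
  by (auto simp: For_def)

lemma wp_StoreI:
  assumes "expr_val e' s \<le> 2 ^ m" and "Q (s(a := (s a)(expr_val e s := expr_val e' s)))"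
  shows "wp R m (Store a e e') Q s"
  using assms by simp

text \<open>The invariant refers to the state after the increment of the counter, and the frame is
  supplied on top of it, so that an invariant mentions only what the body changes. The largest value
  of the counter is the loop bound itself, whence \<open>s b 0 \<le> 2 ^ m\<close>.\<close>

lemma wp_For:
  assumes "i \<notin> mods p" "b \<notin> mods p" "b \<noteq> i"
    and "s b 0 \<le> R" "s b 0 \<le> 2 ^ m"
    and "I 0 (s(i := (s i)(0 := 0)))"
    and step: "\<And>k t. k < s b 0 \<Longrightarrow> I k t \<Longrightarrow> t i 0 = k \<Longrightarrow> \<forall>a. a \<notin> insert i (mods p) \<longrightarrow> t a = s a \<Longrightarrow>
      wp R m p (\<lambda>t'. I (Suc k) (t'(i := (t' i)(0 := Suc k)))) t"
    and post: "\<And>t. I (s b 0) t \<Longrightarrow> \<forall>a. a \<notin> insert i (mods p) \<longrightarrow> t a = s a \<Longrightarrow> Q t"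
  shows "wp R m (For i b p) Q s"
proof -
  let ?e = "Bin Less (Var i) (Var b)"
  let ?p = "Seq p (Store i (Const 0) (Bin Add (Var i) (Const 1)))"
  let ?F = "\<lambda>X s. if expr_val ?e s \<noteq> 0 then wp R m ?p X s else Q s"
  let ?I = "\<lambda>s. expr_val ?e s = 0 \<and> Q s"
  \<comment> \<open>\<open>r\<close> may exceed the number of rounds still needed, because
    \<open>R\<close> is only an upper bound for the length of the loop.\<close>
  have "(?F ^^ r) ?I t"
    if "s b 0 - k \<le> r" "k \<le> s b 0" "I k t" "t i 0 = k" "\<forall>a. a \<notin> insert i (mods p) \<longrightarrow> t a = s a" for r k t
    using that
  proof (induction r arbitrary: k t)
    case 0
    then have "t b 0 = s b 0" using assms(2,3) by auto
    with 0 post show ?case by auto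
  next
    case (Suc r)
    have tb: "t b 0 = s b 0" using assms(2,3) Suc.prems by auto
    show ?case
    proof (cases "k < s b 0")
      case True
      have "wp R m p (wp R m (Store i (Const 0) (Bin Add (Var i) (Const 1))) ((?F ^^ r) ?I)) t"
      proof (rule wp_mono [OF step [OF True Suc.prems(3-5)]])
        fix t' assume 1: "I (Suc k) (t'(i := (t' i)(0 := Suc k)))" "\<forall>a. a \<notin> mods p \<longrightarrow> t' a = t a"
        then have i: "t' i 0 = k" using Suc.prems(4) assms(1) by simp
        have *: "(?F ^^ r) ?I (t'(i := (t' i)(0 := Suc k)))"
          by (rule Suc.IH [OF _ _ 1(1)]) (use 1 Suc.prems True in auto)
        show "wp R m (Store i (Const 0) (Bin Add (Var i) (Const 1))) ((?F ^^ r) ?I) t'"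
        proof (rule wp_StoreI)
          show "(?F ^^ r) ?I (t'(i := (t' i)(expr_val (Const 0) t' := expr_val (Bin Add (Var i) (Const 1)) t')))"
            using * i by simp
        qed (use i True assms(5) in simp)
      qed
      then have "wp R m ?p ((?F ^^ r) ?I) t" by simp
      with True Suc.prems(4) tb show ?thesis by simp
    next
      case False
      then show ?thesis using tb Suc.prems post by auto
    qed
  qed
  from this [OF _ _ assms(6), of R]
  have "(?F ^^ R) ?I (s(i := (s i)(0 := 0)))" using assms(4) by simp
  then have *: "wp R m (While ?e ?p) Q (s(i := (s i)(0 := 0)))" by (subst wp.simps(5))
  have "wp R m (Store i (Const 0) (Const 0)) (wp R m (While ?e ?p) Q) s"
    by (rule wp_StoreI) (use * in \<open>simp_all del: wp.simps\<close>)
  then show ?thesis unfolding For_def by (subst wp.simps(3))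
qed

section \<open>Interval states\<close>

text \<open>Horner's scheme: the digits from position 1 on give \<open>e\<close> by induction, and
  \<open>d 0 + B * e\<close> puts \<open>d 0\<close> below them.\<close>

lemma digits_exist:
  fixes B :: nat
  assumes "\<And>q. q < Q \<Longrightarrow> d q < B"
  shows "\<exists>e<B ^ Q. \<forall>q<Q. e div B ^ q mod B = d q"
  using assms
proof (induction Q arbitrary: d)
  case (Suc Q)
  from Suc.IH [of "d \<circ> Suc"] Suc.prems obtain e
    where e: "e < B ^ Q" "\<forall>q<Q. e div B ^ q mod B = d (Suc q)" by fastforce
  have B: "0 < B" "d 0 < B" using Suc.prems [of 0] by auto
  have "d 0 + B * e < B * Suc e" using B by simp
  also have "\<dots> \<le> B ^ Suc Q" using e(1) by (simp add: Suc_le_eq del: mult_Suc_right)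
  finally have "d 0 + B * e < B ^ Suc Q" .
  moreover have "(d 0 + B * e) div B ^ q mod B = d q" if "q < Suc Q" for q
    using that B e(2) by (cases q) (auto simp: div_mult2_eq)
  ultimately show ?case by blast
qed simp

text \<open>Subtracting 1 from a power makes every digit maximal. Hence the state
  \<open>N - 1\<close> will cover every job.\<close>

lemma digit_pred_power:
  fixes B :: nat
  assumes "0 < B" and "q < Q"
  shows "(B ^ Q - 1) div B ^ q mod B = B - 1"
  using assms(2)
proof (induction q arbitrary: Q)
  case (0 Q)
  then obtain Q' where [simp]: "Q = Suc Q'" by (cases Q) auto
  have "B ^ Q - 1 = (B - 1) + B * (B ^ Q' - 1)"
    using assms(1) by (simp add: diff_mult_distrib2)
  also have "\<dots> mod B = B - 1" using assms(1) by (subst mod_mult_self2) simp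
  finally show ?case by simp
next
  case (Suc q Q)
  then obtain Q' where [simp]: "Q = Suc Q'" and "q < Q'" by (cases Q) auto
  have "B ^ Q - 1 = (B - 1) + B * (B ^ Q' - 1)"
    using assms(1) by (simp add: diff_mult_distrib2)
  also have "\<dots> div B = B ^ Q' - 1" using assms(1) by (subst div_mult_self2) auto
  finally have "(B ^ Q - 1) div B = B ^ Q' - 1" .
  then show ?case using Suc.IH [OF \<open>q < Q'\<close>] by (simp only: power_Suc div_mult2_eq)
qed

section \<open>Types of jobs and ranks within a type\<close>

locale two_load_jobs =
  fixes c n :: nat and l h x :: "nat \<Rightarrow> nat"
  assumes c_pos: "1 \<le> c"
    and low_le_high: "j < n \<Longrightarrow> l j \<le> h j"
begin

definition same :: "nat \<Rightarrow> nat \<Rightarrow> bool" where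
  "same j k \<longleftrightarrow> l j = l k \<and> h j = h k"

text \<open>Ties in \<open>x\<close> are broken by the job number, so that the jobs of a type are
  linearly ordered and have distinct ranks.\<close>

definition before :: "nat \<Rightarrow> nat \<Rightarrow> bool" where
  "before k j \<longleftrightarrow> x k < x j \<or> x k = x j \<and> k < j"

definition rank :: "nat \<Rightarrow> nat" where
  "rank j = card {k. k < n \<and> same k j \<and> before k j}"

definition time :: "nat \<Rightarrow> nat \<Rightarrow> nat" where
  "time i j = (if i < x j then l j else h j)"

definition load :: "(nat \<Rightarrow> nat) \<Rightarrow> nat \<Rightarrow> nat" where
  "load a i = (\<Sum>j | j < n \<and> a j = i. time i j)"

lemma same_trans: "same i j \<Longrightarrow> same j k \<Longrightarrow> same i k"
  by (simp add: same_def)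

lemma same_sym: "same i j \<Longrightarrow> same j i"
  by (simp add: same_def)

lemma before_trans: "before i j \<Longrightarrow> before j k \<Longrightarrow> before i k"
  unfolding before_def by linarith

lemma not_before_refl: "\<not> before j j"
  by (simp add: before_def)

lemma same_rank_mono:
  assumes "same j k" "before j k" "j < n"
  shows "rank j < rank k"
proof -
  have "{i. i < n \<and> same i j \<and> before i j} \<subset> {i. i < n \<and> same i k \<and> before i k}"
    using assms same_trans before_trans not_before_refl by blast
  then show ?thesis unfolding rank_def by (intro psubset_card_mono) auto
qed

lemma inj_on_rank: "inj_on rank {k. k < n \<and> same k j}"
proof (rule inj_onI)
  fix i k assume *: "i \<in> {k. k < n \<and> same k j}" "k \<in> {k. k < n \<and> same k j}" "rank i = rank k"
  then have "same i k" "same k i" using same_trans same_sym by blast+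
  with * have "\<not> before i k" "\<not> before k i"
    using same_rank_mono [of i k] same_rank_mono [of k i] by auto
  then show "i = k" unfolding before_def by linarith
qed

text \<open>All predecessors of \<open>j\<close> have an \<open>x\<close> of at most
  \<open>x j\<close>, and \<open>j\<close> itself makes the inequality strict. It is applied
  backwards: few jobs with small \<open>x\<close> force a small rank.\<close>

lemma rank_less_card:
  assumes "j < n"
  shows "rank j < card {k. k < n \<and> same k j \<and> x k \<le> x j}"
  unfolding rank_def
proof (rule psubset_card_mono)
  have "same j j" by (simp add: same_def)
  moreover have "before k j \<Longrightarrow> x k \<le> x j" for k unfolding before_def by linarith
  ultimately show "{k. k < n \<and> same k j \<and> before k j} \<subset> {k. k < n \<and> same k j \<and> x k \<le> x j}"
    using assms not_before_refl by blast
qed simp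

text \<open>Ranks are injective within a type; this turns lengths of rank intervals into bounds on
  the number of jobs charged to a machine.\<close>

lemma card_rank_le: "card {k. k < n \<and> same k j \<and> u \<le> rank k \<and> rank k < v} \<le> v - u"
proof -
  have "card {k. k < n \<and> same k j \<and> u \<le> rank k \<and> rank k < v} =
      card (rank ` {k. k < n \<and> same k j \<and> u \<le> rank k \<and> rank k < v})"
    by (intro card_image [symmetric] inj_on_subset [OF inj_on_rank [of j]]) auto
  also have "\<dots> \<le> card {u..<v}" by (rule card_mono) auto
  finally show ?thesis by simp
qed

lemma time_le: "j < n \<Longrightarrow> time i j \<le> h j"
  using low_le_high by (simp add: time_def)

section \<open>Numbering the types and placing their digits\<close>

definition num_types :: "nat \<Rightarrow> nat" where
  "num_types i = card ((\<lambda>j. (l j, h j)) ` {..<i})"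

lemma num_types_mono: "i \<le> k \<Longrightarrow> num_types i \<le> num_types k"
  unfolding num_types_def by (intro card_mono image_mono) auto

lemma num_types_Suc: "num_types (Suc i) = num_types i + of_bool (\<forall>k<i. \<not> same k i)"
proof -
  let ?f = "\<lambda>j. (l j, h j)"
  have "?f i \<in> ?f ` {..<i} \<longleftrightarrow> (\<exists>k<i. same k i)"
    unfolding same_def image_iff Bex_def lessThan_iff prod.inject by metis
  moreover have "?f ` {..<Suc i} = insert (?f i) (?f ` {..<i})" by (simp only: lessThan_Suc image_insert)
  ultimately show ?thesis unfolding num_types_def by (simp add: card_insert_if)
qed

text \<open>A state is a number below \<open>N\<close>; \<open>W j\<close> is the place value of the first of the two
  base-\<open>(n + 1)\<close> digits that it reserves for the type (the pair of loads) of job \<open>j\<close>.\<close>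

definition place_values :: "nat \<Rightarrow> (nat \<Rightarrow> nat) \<Rightarrow> nat \<Rightarrow> bool" where
  "place_values i W N \<longleftrightarrow> N = (n + 1) ^ (2 * num_types i) \<and>
     (\<exists>p. (\<forall>j<i. p j < num_types i \<and> W j = (n + 1) ^ (2 * p j)) \<and>
       (\<forall>j<i. \<forall>k<i. p j = p k \<longleftrightarrow> same j k))"

lemma place_values_0: "place_values 0 W 1"
  by (simp add: place_values_def num_types_def)

text \<open>Jobs of one type must share their digits, so job \<open>i\<close> takes over those of
  \<open>k\<close> and \<open>N\<close> stays.\<close>

lemma place_values_old:
  assumes "place_values i W N" and k: "k < i" "same k i"
    and W': "\<And>j. j < i \<Longrightarrow> W' j = W j" "W' i = W k"
  shows "place_values (Suc i) W' N"
proof -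
  from assms(1) obtain p where N: "N = (n + 1) ^ (2 * num_types i)"
    and p: "\<forall>j<i. p j < num_types i \<and> W j = (n + 1) ^ (2 * p j)"
    and same: "\<forall>j<i. \<forall>k<i. p j = p k \<longleftrightarrow> same j k" unfolding place_values_def by blast
  have num: "num_types (Suc i) = num_types i" using num_types_Suc [of i] k by auto
  define p' where "p' = p(i := p k)"
  have "p' j < num_types i \<and> W' j = (n + 1) ^ (2 * p' j)" if "j < Suc i" for j
    using that p W' k by (cases "j = i") (auto simp: p'_def)
  moreover have "p' j = p' k' \<longleftrightarrow> same j k'" if "j < Suc i" "k' < Suc i" for j k'
  proof -
    have *: "same i i" "same k i" "same i k" using k(2) by (simp_all add: same_def)
    have "same j k \<longleftrightarrow> same j i" "same k j \<longleftrightarrow> same i j" for j using * same_trans by blast+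
    then show ?thesis
      using that same k(1) * unfolding p'_def by (cases "j = i"; cases "k' = i") auto
  qed
  ultimately show ?thesis unfolding place_values_def num using N by blast
qed

text \<open>The new type takes the next free position \<open>num_types i\<close>, whose place value
  is the current \<open>N\<close>; its two digits account for the new factor of the number of
  states.\<close>

lemma place_values_new:
  assumes "place_values i W N" and k: "\<And>k. k < i \<Longrightarrow> \<not> same k i"
    and W': "\<And>j. j < i \<Longrightarrow> W' j = W j" "W' i = N"
  shows "place_values (Suc i) W' (N * ((n + 1) * (n + 1)))"
proof -
  from assms(1) obtain p where N: "N = (n + 1) ^ (2 * num_types i)"
    and p: "\<forall>j<i. p j < num_types i \<and> W j = (n + 1) ^ (2 * p j)"
    and same: "\<forall>j<i. \<forall>k<i. p j = p k \<longleftrightarrow> same j k" unfolding place_values_def by blast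
  have num: "num_types (Suc i) = Suc (num_types i)" using num_types_Suc [of i] k by auto
  define p' where "p' = p(i := num_types i)"
  have "p' j < Suc (num_types i) \<and> W' j = (n + 1) ^ (2 * p' j)" if "j < Suc i" for j
  proof (cases "j = i")
    case True
    then show ?thesis using W'(2) N by (simp add: p'_def)
  next
    case False
    then have "j < i" using that by simp
    then show ?thesis using p W'(1) False by (simp add: p'_def less_SucI)
  qed
  moreover have "p' j = p' k' \<longleftrightarrow> same j k'" if "j < Suc i" "k' < Suc i" for j k'
  proof -
    have *: "p k \<noteq> num_types i" "num_types i \<noteq> p k" "\<not> same k i" "\<not> same i k" if "k < i" for k
      using that p k same_sym by auto
    show ?thesis
      using that same * unfolding p'_def by (cases "j = i"; cases "k' = i") (auto simp: same_def [of i i])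
  qed
  moreover have "N * ((n + 1) * (n + 1)) = (n + 1) ^ (2 * Suc (num_types i))"
    by (simp add: N algebra_simps)
  ultimately show ?thesis unfolding place_values_def num by blast
qed

end

section \<open>States as intervals of ranks, and paths of states\<close>

locale two_load_states = two_load_jobs +
  fixes W :: "nat \<Rightarrow> nat" and N :: nat
  assumes place_values: "place_values n W N"
begin

lemma weights: "\<exists>p P. N = (n + 1) ^ (2 * P) \<and>
    (\<forall>j<n. p j < P \<and> W j = (n + 1) ^ (2 * p j)) \<and>
    (\<forall>j<n. \<forall>k<n. p j = p k \<longleftrightarrow> same j k)"
  using place_values unfolding place_values_def by blast

text \<open>The first digit of a type is the upper end of its interval of ranks, the second is
  \<open>n\<close> minus the lower end. Digits 0 thus give the empty interval, and digits
  \<open>n\<close> all ranks.\<close>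

definition covered :: "nat \<Rightarrow> nat \<Rightarrow> bool" where
  "covered e j \<longleftrightarrow> rank j < e div W j mod (n + 1) \<and>
     n \<le> rank j + e div (W j * (n + 1)) mod (n + 1)"

text \<open>Jobs that drop out of the covered set are not credited, which makes arbitrary pairs of
  states admissible.\<close>

definition weight :: "nat \<Rightarrow> nat \<Rightarrow> nat \<Rightarrow> nat" where
  "weight i d e = (\<Sum>j | j < n \<and> covered e j \<and> \<not> covered d j. time i j)"

lemma N_pos: "0 < N"
  using weights by auto

lemma rank_less:
  assumes "j < n"
  shows "rank j < n"
proof -
  have "card {k. k < n \<and> same k j \<and> x k \<le> x j} \<le> card {..<n}" by (rule card_mono) auto
  then show ?thesis using rank_less_card [OF assms] by simp
qed

lemma not_covered_0: "\<not> covered 0 j"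
  by (simp add: covered_def)

lemma covered_last:
  assumes "j < n"
  shows "covered (N - 1) j"
proof -
  from weights obtain p P where "N = (n + 1) ^ (2 * P)" "p j < P" "W j = (n + 1) ^ (2 * p j)"
    using assms by blast
  moreover from this have "(N - 1) div W j mod (n + 1) = n"
    using digit_pred_power [of "n + 1" "2 * p j" "2 * P"] by simp
  moreover have "(N - 1) div (W j * (n + 1)) mod (n + 1) = n"
    using digit_pred_power [of "n + 1" "Suc (2 * p j)" "2 * P"] calculation
    by (simp add: mult.commute)
  ultimately show ?thesis using rank_less [OF assms] by (simp add: covered_def)
qed

text \<open>With \<open>m\<close> jobs of a type running high in total, and \<open>G i\<close> and \<open>H i\<close> of them running low and high
  on the machines up to \<open>i\<close>, the first \<open>i\<close> machines may as well take the ranks in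
  \<open>[m - H i, m + G i)\<close>: a job with \<open>x \<le> i\<close> is either counted in \<open>m\<close> or in \<open>G (i - 1)\<close>,
  so that the low extension of this interval on machine \<open>i\<close> consists of jobs with \<open>i < x\<close>.\<close>

lemma state_path_of_assignment:
  assumes a: "\<forall>j<n. a j \<in> {1..c}"
  shows "\<exists>es. es 0 = 0 \<and> es c = N - 1 \<and> (\<forall>i. es i < N) \<and>
    (\<forall>i\<in>{1..c}. weight i (es (i - 1)) (es i) \<le> load a i)"
proof -
  from weights obtain p P where N: "N = (n + 1) ^ (2 * P)"
    and p: "\<And>j. j < n \<Longrightarrow> p j < P \<and> W j = (n + 1) ^ (2 * p j)"
    and same: "\<And>j k. j < n \<Longrightarrow> k < n \<Longrightarrow> p j = p k \<longleftrightarrow> same j k" by blast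
  define C where "C q = {j. j < n \<and> p j = q}" for q
  \<comment> \<open>\<open>H q c\<close> plays the part of m, and \<open>G q c + H q c\<close> is
    the size of the type.\<close>
  define G where "G q i = card {j \<in> C q. a j \<le> i \<and> a j < x j}" for q i
  define H where "H q i = card {j \<in> C q. a j \<le> i \<and> x j \<le> a j}" for q i
  have fin [simp]: "finite (C q)" for q by (simp add: C_def)
  have H_mono: "H q i \<le> H q i'" if "i \<le> i'" for q i i'
    unfolding H_def by (rule card_mono) (use that in auto)
  have G_mono: "G q i \<le> G q i'" if "i \<le> i'" for q i i'
    unfolding G_def by (rule card_mono) (use that in auto)
  have all: "G q c + H q c = card (C q)" for q
  proof -
    have "G q c + H q c = card ({j \<in> C q. a j \<le> c \<and> a j < x j} \<union> {j \<in> C q. a j \<le> c \<and> x j \<le> a j})"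
      unfolding G_def H_def by (rule card_Un_disjoint [symmetric]) auto
    also have "{j \<in> C q. a j \<le> c \<and> a j < x j} \<union> {j \<in> C q. a j \<le> c \<and> x j \<le> a j} = C q"
      using a by (auto simp: C_def)
    finally show ?thesis .
  qed
  have zero: "G q 0 = 0" "H q 0 = 0" for q
  proof -
    have "{j \<in> C q. a j \<le> 0 \<and> a j < x j} = {}" "{j \<in> C q. a j \<le> 0 \<and> x j \<le> a j} = {}"
      using a by (auto simp: C_def)
    then show "G q 0 = 0" "H q 0 = 0" by (simp_all only: G_def H_def card.empty)
  qed
  have cardC: "card (C q) \<le> n" for q
    using card_mono [of "{..<n}" "C q"] by (auto simp: C_def)
  \<comment> \<open>Even positions hold the upper end m + G, odd positions \<open>n\<close> minus
    the lower end m - H.\<close>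
  define d where "d i r = (if even r then H (r div 2) c + G (r div 2) i
    else n - (H (r div 2) c - H (r div 2) i))" for i r
  have bound: "H q c + G q i \<le> n" if "i \<le> c" for i q
    using all [of q] G_mono [OF that, of q] cardC [of q] by linarith
  have "\<exists>e<N. \<forall>r<2 * P. e div (n + 1) ^ r mod (n + 1) = d i r" if "i \<le> c" for i
    unfolding N by (rule digits_exist) (use bound [OF that] in \<open>auto simp: d_def le_imp_less_Suc\<close>)
  then obtain E where E: "\<And>i. i \<le> c \<Longrightarrow> E i < N"
    "\<And>i r. i \<le> c \<Longrightarrow> r < 2 * P \<Longrightarrow> E i div (n + 1) ^ r mod (n + 1) = d i r" by metis
  define interval where
    "interval i j \<longleftrightarrow> H (p j) c - H (p j) i \<le> rank j \<and> rank j < H (p j) c + G (p j) i" for i j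
  have cov: "covered (E i) j \<longleftrightarrow> interval i j" if "i \<le> c" "j < n" for i j
  proof -
    have pj: "p j < P" and Wj: "W j = (n + 1) ^ (2 * p j)" using p [OF that(2)] by auto
    have "E i div W j mod (n + 1) = H (p j) c + G (p j) i"
      using E(2) [OF that(1), of "2 * p j"] pj Wj by (simp add: d_def)
    moreover have "E i div (W j * (n + 1)) mod (n + 1) = n - (H (p j) c - H (p j) i)"
      using E(2) [OF that(1), of "Suc (2 * p j)"] pj Wj by (simp add: d_def mult.commute)
    moreover have "H (p j) c \<le> n" using bound [of 0 "p j"] by simp
    ultimately show ?thesis by (auto simp: covered_def interval_def)
  qed
  \<comment> \<open>The digits of \<open>E 0\<close> and \<open>E c\<close> describe an empty and a
    full interval but need not all be 0 or \<open>n\<close>. The states \<open>0\<close> and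
    \<open>N - 1\<close> cover the same jobs and are the end points that the algorithm knows.
    Indices beyond \<open>c\<close> only need a value below \<open>N\<close>.\<close>
  define es where "es i = (if i = 0 then 0 else if c \<le> i then N - 1 else E i)" for i
  have cov': "covered (es i) j \<longleftrightarrow> interval i j" if "i \<le> c" "j < n" for i j
  proof -
    have "\<not> interval 0 j" by (simp add: interval_def zero)
    moreover have "interval c j"
    proof -
      have "{k. k < n \<and> same k j \<and> x k \<le> x j} \<subseteq> C (p j)"
        using that same by (auto simp: C_def)
      then have "rank j < card (C (p j))"
        using rank_less_card [OF that(2)] card_mono [of "C (p j)"] by (meson fin less_le_trans)
      then show ?thesis using all [of "p j"] by (simp add: interval_def)
    qed
    ultimately show ?thesis
      using cov [OF that] that not_covered_0 covered_last [OF that(2)] by (auto simp: es_def)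
  qed
  have key: "weight i (es (i - 1)) (es i) \<le> load a i" if i: "i \<in> {1..c}" for i
  proof -
    let ?S = "{j. j < n \<and> interval i j \<and> \<not> interval (i - 1) j}"
    have wt: "weight i (es (i - 1)) (es i) = sum (time i) ?S"
    proof -
      have "{j. j < n \<and> covered (es i) j \<and> \<not> covered (es (i - 1)) j} = ?S"
        using i cov' [of i] cov' [of "i - 1"] by auto
      then show ?thesis by (simp add: weight_def)
    qed
    \<comment> \<open>The jobs newly covered by machine \<open>i\<close> need not be those that
      \<open>a\<close> runs there; within one type it is enough to compare how many run low and how
      many run high.\<close>
    have "sum (time i) {j \<in> ?S. p j = q} \<le> sum (time i) {j \<in> {j. j < n \<and> a j = i}. p j = q}"
      if "q < P" for q
    proof (cases "C q = {}")
      case True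
      then have "{j \<in> ?S. p j = q} = {}" by (auto simp: C_def)
      then show ?thesis by (simp only: sum.empty)
    next
      case False
      then obtain j0 where j0: "j0 < n" "p j0 = q" by (auto simp: C_def)
      have C: "C q = {k. k < n \<and> same k j0}" using same j0 by (auto simp: C_def)
      have lh: "l j = l j0" "h j = h j0" if "j \<in> C q" for j using that C by (auto simp: same_def)
      \<comment> \<open>\<open>?A\<close> extends the interval downwards by as many ranks as
        \<open>a\<close> runs jobs of this type high on machine \<open>i\<close>; \<open>?B\<close>
        extends it upwards by the number run low.\<close>
      let ?A = "{k. k < n \<and> same k j0 \<and> H q c - H q i \<le> rank k \<and> rank k < H q c - H q (i - 1)}"
      let ?B = "{k. k < n \<and> same k j0 \<and> H q c + G q (i - 1) \<le> rank k \<and> rank k < H q c + G q i}"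
      have Hi: "H q (i - 1) \<le> H q i" "H q i \<le> H q c" "G q (i - 1) \<le> G q i"
        using i by (auto intro: H_mono G_mono)
      have sub: "{j \<in> ?S. p j = q} \<subseteq> ?A \<union> ?B"
      proof
        fix j assume "j \<in> {j \<in> ?S. p j = q}"
        then have "j < n" "p j = q" "interval i j" "\<not> interval (i - 1) j" by auto
        moreover from this have "same j j0" using C by (auto simp: C_def)
        ultimately show "j \<in> ?A \<union> ?B" unfolding interval_def by simp linarith
      qed
      \<comment> \<open>A job of the lower extension might even run low here; it may be charged its
        high load all the same.\<close>
      have tA: "time i j \<le> h j0" if "j \<in> ?A" for j
      proof -
        from that have "j < n" "j \<in> C q" using C by blast+
        then show ?thesis using low_le_high [of j] lh [of j] by (simp add: time_def)
      qed
      have tB: "time i j = l j0" if "j \<in> ?B" for j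
      proof -
        from that have j: "j < n" "j \<in> C q" "same j j0" "H q c + G q (i - 1) \<le> rank j"
          using C by blast+
        \<comment> \<open>Otherwise more than \<open>rank j\<close> jobs of the type have an
          \<open>x\<close> of at most \<open>i\<close>, while at most
          \<open>G q (i - 1) + H q c\<close> do.\<close>
        have "i < x j"
        proof (rule ccontr)
          assume "\<not> i < x j"
          have "{k. k < n \<and> same k j \<and> x k \<le> x j} \<subseteq>
              {j \<in> C q. a j \<le> i - 1 \<and> a j < x j} \<union> {j \<in> C q. a j \<le> c \<and> x j \<le> a j}"
          proof
            fix k assume k: "k \<in> {k. k < n \<and> same k j \<and> x k \<le> x j}"
            then have "k \<in> C q" "a k \<le> c" using C same_trans [OF _ j(3)] a by auto
            moreover have "a k \<le> i - 1 \<or> x k \<le> a k" using k \<open>\<not> i < x j\<close> by simp linarith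
            ultimately show "k \<in> {j \<in> C q. a j \<le> i - 1 \<and> a j < x j} \<union> {j \<in> C q. a j \<le> c \<and> x j \<le> a j}"
              by (cases "a k < x k") simp_all
          qed
          then have "card {k. k < n \<and> same k j \<and> x k \<le> x j} \<le>
              card ({j \<in> C q. a j \<le> i - 1 \<and> a j < x j} \<union> {j \<in> C q. a j \<le> c \<and> x j \<le> a j})"
            by (rule card_mono [rotated]) simp
          also have "\<dots> \<le> G q (i - 1) + H q c" unfolding G_def H_def by (rule card_Un_le)
          finally show False using rank_less_card [OF j(1)] j(4) by simp
        qed
        then show ?thesis using lh [OF j(2)] by (simp add: time_def)
      qed
      have "sum (time i) {j \<in> ?S. p j = q} \<le> sum (time i) (?A \<union> ?B)"
        by (rule sum_mono2 [OF _ sub]) auto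
      also have "\<dots> = sum (time i) ?A + sum (time i) ?B"
      proof (rule sum.union_disjoint)
        have "\<not> H q c + G q (i - 1) \<le> rank k" if "rank k < H q c - H q (i - 1)" for k
          using that by linarith
        then show "?A \<inter> ?B = {}" by blast
      qed simp_all
      also have "\<dots> \<le> card ?A * h j0 + card ?B * l j0"
        using sum_bounded_above [of ?A "time i" "h j0"] sum_bounded_above [of ?B "time i" "l j0"] tA tB
        by (intro add_mono) auto
      also have "\<dots> \<le> (H q i - H q (i - 1)) * h j0 + (G q i - G q (i - 1)) * l j0"
      proof -
        have "card ?A \<le> H q i - H q (i - 1)"
          using card_rank_le [of j0 "H q c - H q i" "H q c - H q (i - 1)"] Hi by linarith
        moreover have "card ?B \<le> G q i - G q (i - 1)"
          using card_rank_le [of j0 "H q c + G q (i - 1)" "H q c + G q i"] Hi by linarith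
        ultimately show ?thesis by (intro add_mono mult_right_mono) simp_all
      qed
      \<comment> \<open>From here on the counts are exact: the differences of \<open>H\<close> and
        \<open>G\<close> are the jobs that \<open>a\<close> places on machine \<open>i\<close>
        itself.\<close>
      also have "\<dots> = sum (time i) {j \<in> C q. a j = i \<and> x j \<le> i} + sum (time i) {j \<in> C q. a j = i \<and> i < x j}"
      proof -
        have "H q i - H q (i - 1) = card {j \<in> C q. a j = i \<and> x j \<le> i}"
        proof -
          have *: "{j \<in> C q. a j = i \<and> x j \<le> i} =
              {j \<in> C q. a j \<le> i \<and> x j \<le> a j} - {j \<in> C q. a j \<le> i - 1 \<and> x j \<le> a j}"
            using i by auto
          show ?thesis unfolding H_def * by (rule card_Diff_subset [symmetric]) auto
        qed
        moreover have "G q i - G q (i - 1) = card {j \<in> C q. a j = i \<and> i < x j}"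
        proof -
          have *: "{j \<in> C q. a j = i \<and> i < x j} =
              {j \<in> C q. a j \<le> i \<and> a j < x j} - {j \<in> C q. a j \<le> i - 1 \<and> a j < x j}"
            using i by auto
          show ?thesis unfolding G_def * by (rule card_Diff_subset [symmetric]) auto
        qed
        moreover have "sum (time i) {j \<in> C q. a j = i \<and> x j \<le> i} = (\<Sum>j\<in>{j \<in> C q. a j = i \<and> x j \<le> i}. h j0)"
          by (rule sum.cong) (auto simp: time_def lh)
        moreover have "sum (time i) {j \<in> C q. a j = i \<and> i < x j} = (\<Sum>j\<in>{j \<in> C q. a j = i \<and> i < x j}. l j0)"
          by (rule sum.cong) (auto simp: time_def lh)
        ultimately show ?thesis by simp
      qed
      also have "\<dots> = sum (time i) ({j \<in> C q. a j = i \<and> x j \<le> i} \<union> {j \<in> C q. a j = i \<and> i < x j})"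
        by (rule sum.union_disjoint [symmetric]) auto
      also have "{j \<in> C q. a j = i \<and> x j \<le> i} \<union> {j \<in> C q. a j = i \<and> i < x j} =
          {j \<in> {j. j < n \<and> a j = i}. p j = q}" by (auto simp: C_def)
      finally show ?thesis .
    qed
    then have "(\<Sum>q<P. sum (time i) {j \<in> ?S. p j = q}) \<le>
        (\<Sum>q<P. sum (time i) {j \<in> {j. j < n \<and> a j = i}. p j = q})"
      by (intro sum_mono) auto
    moreover have "(\<Sum>q<P. sum (time i) {j \<in> ?S. p j = q}) = sum (time i) ?S"
      by (rule sum.group) (use p in auto)
    moreover have "(\<Sum>q<P. sum (time i) {j \<in> {j. j < n \<and> a j = i}. p j = q}) = load a i"
      unfolding load_def by (rule sum.group) (use p in auto)
    ultimately show ?thesis using wt by simp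
  qed
  have "es i < N" for i using E(1) [of i] N_pos by (simp add: es_def)
  moreover have "es 0 = 0" "es c = N - 1" using c_pos by (auto simp: es_def)
  ultimately show ?thesis using key by blast
qed

section \<open>The minimax recurrence and its backtracking\<close>

text \<open>\<open>f i e\<close> is the least possible maximum load of the machines up to \<open>i\<close> on a path from state 0
  to state \<open>e\<close>, and \<open>b i e\<close> the last but one state on such a path to \<open>e\<close> at level \<open>Suc i\<close>.  On level 0
  only state 0 is admitted.\<close>

definition table_entry ::
    "nat \<Rightarrow> nat \<Rightarrow> nat \<Rightarrow> (nat \<Rightarrow> nat \<Rightarrow> nat) \<Rightarrow> (nat \<Rightarrow> nat \<Rightarrow> nat) \<Rightarrow> bool" where
  "table_entry M i e f b \<longleftrightarrow> b i e < M \<and>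
     f (Suc i) e = max (weight (Suc i) (b i e) e) (f i (b i e)) \<and>
     (\<forall>d<M. f (Suc i) e \<le> max (weight (Suc i) d e) (f i d))"

definition optimal_table :: "(nat \<Rightarrow> nat \<Rightarrow> nat) \<Rightarrow> (nat \<Rightarrow> nat \<Rightarrow> nat) \<Rightarrow> bool" where
  "optimal_table f b \<longleftrightarrow> f 0 0 = 0 \<and>
     (\<forall>i<c. \<forall>e<N. table_entry (if i = 0 then 1 else N) i e f b)"

text \<open>An entry depends only on its own cells and on the previous row, so finished entries
  survive writes elsewhere.\<close>

lemma table_entry_cong:
  assumes "f' (Suc i) e = f (Suc i) e" "b' i e = b i e" "\<And>d. d < M \<Longrightarrow> f' i d = f i d"
  shows "table_entry M i e f' b' \<longleftrightarrow> table_entry M i e f b"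
  using assms by (auto simp: table_entry_def)

lemma optimal_tableD:
  assumes "optimal_table f b" and "i < c" and "e < N"
  shows "b i e < (if i = 0 then 1 else N)"
    and "f (Suc i) e = max (weight (Suc i) (b i e) e) (f i (b i e))"
    and "d < (if i = 0 then 1 else N) \<Longrightarrow> f (Suc i) e \<le> max (weight (Suc i) d e) (f i d)"
  using assms unfolding optimal_table_def table_entry_def by blast+

text \<open>The minimum at each level is compared with one candidate, the predecessor on the path
  that \<open>state_path_of_assignment\<close> obtains from \<open>a\<close>.\<close>

lemma optimal_table_le:
  assumes t: "optimal_table f b" and a: "\<forall>j<n. a j \<in> {1..c}"
    and T: "\<forall>i\<in>{1..c}. load a i \<le> T"
  shows "f c (N - 1) \<le> T"
proof -
  from state_path_of_assignment [OF a] obtain es where es: "es 0 = 0" "es c = N - 1" "\<And>i. es i < N"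
    "\<And>i. i \<in> {1..c} \<Longrightarrow> weight i (es (i - 1)) (es i) \<le> load a i" by blast
  have "f i (es i) \<le> T" if "i \<le> c" for i
    using that
  proof (induction i)
    case 0
    then show ?case using t es(1) by (simp add: optimal_table_def)
  next
    case (Suc i)
    have "f (Suc i) (es (Suc i)) \<le> max (weight (Suc i) (es i) (es (Suc i))) (f i (es i))"
    proof -
      have "es i < (if i = 0 then 1 else N)" using es(1) es(3) [of i] by simp
      then show ?thesis
        using optimal_tableD(3) [OF t, of i "es (Suc i)"] Suc.prems es(3) [of "Suc i"] by simp
    qed
    moreover have "weight (Suc i) (es i) (es (Suc i)) \<le> T"
      using es(4) [of "Suc i"] bspec [OF T, of "Suc i"] Suc.prems by simp
    ultimately show ?case using Suc by auto
  qed
  from this [of c] es(2) show ?thesis by simp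
qed

text \<open>\<open>trace b k\<close> lives on level \<open>c - k\<close>.\<close>

primrec trace :: "(nat \<Rightarrow> nat \<Rightarrow> nat) \<Rightarrow> nat \<Rightarrow> nat" where
  "trace b 0 = N - 1"
| "trace b (Suc k) = b (c - Suc k) (trace b k)"

lemma trace_less:
  assumes "optimal_table f b" and "k \<le> c"
  shows "trace b k < N"
  using assms(2)
proof (induction k)
  case 0
  then show ?case using N_pos by simp
next
  case (Suc k)
  then have "b (c - Suc k) (trace b k) < (if c - Suc k = 0 then 1 else N)"
    using optimal_tableD(1) [OF assms(1), of "c - Suc k" "trace b k"] by simp
  then show ?case using N_pos by (auto split: if_splits)
qed

text \<open>Level 0 admits only state 0. As this state covers nothing, every job becomes covered
  somewhere along the trace.\<close>

lemma trace_end: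
  assumes "optimal_table f b"
  shows "trace b c = 0"
proof -
  have "trace b (c - 1) < N" by (rule trace_less [OF assms]) simp
  then have "b (c - c) (trace b (c - 1)) = 0"
    using optimal_tableD(1) [OF assms, of 0 "trace b (c - 1)"] c_pos by simp
  moreover have "trace b c = trace b (Suc (c - 1))" using c_pos by simp
  ultimately show ?thesis using c_pos unfolding trace.simps by simp
qed

text \<open>An entry is the maximum of the weight of its last step and the entry of its predecessor,
  so neither exceeds the final value on the way back.\<close>

lemma trace_value:
  assumes "optimal_table f b" and "k \<le> c"
  shows "f (c - k) (trace b k) \<le> f c (N - 1) \<and>
    (k < c \<longrightarrow> weight (c - k) (trace b (Suc k)) (trace b k) \<le> f c (N - 1))"
proof -
  have *: "f (c - k) (trace b k) =
      max (weight (c - k) (trace b (Suc k)) (trace b k)) (f (c - Suc k) (trace b (Suc k)))" if "k < c" for k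
  proof -
    have "c - k = Suc (c - Suc k)" "c - Suc k < c" "trace b k < N"
      using that trace_less [OF assms(1), of k] by auto
    then show ?thesis using optimal_tableD(2) [OF assms(1), of "c - Suc k" "trace b k"] by simp
  qed
  have "f (c - k) (trace b k) \<le> f c (N - 1)"
    using assms(2)
  proof (induction k)
    case (Suc k)
    then show ?case using * [of k] by simp
  qed simp
  then show ?thesis using * [of k] by auto
qed

text \<open>One inclusion suffices: a job put on machine \<open>i\<close> is newly covered in that
  step and hence charged there. Jobs covered repeatedly only raise the weights.\<close>

lemma trace_assignment_optimal:
  assumes "optimal_table f b"
    and out: "\<And>j. j < n \<Longrightarrow> \<exists>k<c. out j = c - k \<and> covered (trace b k) j \<and> \<not> covered (trace b (Suc k)) j"
    and a: "\<forall>j<n. a j \<in> {1..c}" and T: "\<forall>i\<in>{1..c}. load a i \<le> T" and i: "i \<in> {1..c}"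
  shows "load out i \<le> T"
proof -
  define k where "k = c - i"
  have k: "k < c" "i = c - k" using i by (auto simp: k_def)
  have "load out i \<le> weight i (trace b (Suc k)) (trace b k)"
    unfolding load_def weight_def
  proof (rule sum_mono2)
    show "{j. j < n \<and> out j = i} \<subseteq> {j. j < n \<and> covered (trace b k) j \<and> \<not> covered (trace b (Suc k)) j}"
    proof clarsimp
      fix j assume j: "j < n" "i = out j"
      from out [OF j(1)] obtain k' where "k' < c" "out j = c - k'"
        "covered (trace b k') j \<and> \<not> covered (trace b (Suc k')) j" by blast
      moreover from this k j have "k' = k" by linarith
      ultimately show "covered (trace b k) j \<and> \<not> covered (b (c - Suc k) (trace b k)) j" by simp
    qed
  qed auto
  also have "\<dots> \<le> f c (N - 1)" using trace_value [OF assms(1), of k] k by auto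
  also have "\<dots> \<le> T" using optimal_table_le [OF assms(1) a T] .
  finally show ?thesis .
qed

end

section \<open>The program\<close>

abbreviation Set :: "name \<Rightarrow> expr \<Rightarrow> com" where "Set a e \<equiv> Store a (Const 0) e"
abbreviation Plus :: "expr \<Rightarrow> expr \<Rightarrow> expr" where "Plus \<equiv> Bin Add"
abbreviation Times :: "expr \<Rightarrow> expr \<Rightarrow> expr" where "Times \<equiv> Bin Mul"

text \<open>As conjunction is multiplication, \<open>AndE\<close> also multiplies a number by a truth value.\<close>

definition NotE :: "expr \<Rightarrow> expr" where "NotE e = Bin Sub (Const 1) e"
definition LessE :: "expr \<Rightarrow> expr \<Rightarrow> expr" where "LessE e e' = Bin Less e e'"
definition AndE :: "expr \<Rightarrow> expr \<Rightarrow> expr" where "AndE e e' = Bin Mul e e'"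
definition OrE :: "expr \<Rightarrow> expr \<Rightarrow> expr" where "OrE e e' = NotE (AndE (NotE e) (NotE e'))"
definition EqE :: "expr \<Rightarrow> expr \<Rightarrow> expr" where "EqE e e' = AndE (NotE (LessE e e')) (NotE (LessE e' e))"
definition ModE :: "expr \<Rightarrow> expr \<Rightarrow> expr" where "ModE e e' = Bin Sub e (Bin Mul (Bin Div e e') e')"

lemma expr_val_logic [simp]:
  "expr_val (NotE e) s = of_bool (expr_val e s = 0)"
  "expr_val (LessE e e') s = of_bool (expr_val e s < expr_val e' s)"
  "expr_val (AndE e e') s = expr_val e s * expr_val e' s"
  "expr_val (OrE e e') s = of_bool (expr_val e s \<noteq> 0 \<or> expr_val e' s \<noteq> 0)"
  "expr_val (EqE e e') s = of_bool (expr_val e s = expr_val e' s)"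
  "expr_val (ModE e e') s = expr_val e s mod expr_val e' s"
  by (auto simp: NotE_def LessE_def AndE_def OrE_def EqE_def ModE_def minus_div_mult_eq_mod not_less_iff_gr_or_eq)

text \<open>Job j occupies the five cells from 5 j + 2 on. The product of all denominators serves as
  the common one: it is computed without gcds and is no longer than the input.\<close>

definition read_prog :: com where
  "read_prog =
     Seq (Set ''c'' (Load ''in'' (Const 0)))
    (Seq (Set ''n'' (Load ''in'' (Const 1)))
    (Seq (Set ''D'' (Const 1))
    (Seq (For ''j'' ''n'' (Set ''D'' (Times (Var ''D'')
           (Times (Load ''in'' (Plus (Times (Const 5) (Var ''j'')) (Const 3)))
             (Load ''in'' (Plus (Times (Const 5) (Var ''j'')) (Const 5)))))))
         (For ''j'' ''n''
           (Seq (Store ''l'' (Var ''j'') (Bin Div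
             (Times (Load ''in'' (Plus (Times (Const 5) (Var ''j'')) (Const 2))) (Var ''D''))
             (Load ''in'' (Plus (Times (Const 5) (Var ''j'')) (Const 3)))))
           (Seq (Store ''h'' (Var ''j'') (Bin Div
             (Times (Load ''in'' (Plus (Times (Const 5) (Var ''j'')) (Const 4))) (Var ''D''))
             (Load ''in'' (Plus (Times (Const 5) (Var ''j'')) (Const 5)))))
           (Store ''x'' (Var ''j'') (Load ''in'' (Plus (Times (Const 5) (Var ''j'')) (Const 6))))))))))"

text \<open>\<open>g\<close> is the factor by which job \<open>j\<close> enlarges the number of
  states: it becomes 1 as soon as an earlier job of the same type is met. The same pass counts the
  rank, which depends on later jobs as well.\<close>

definition scan_body :: com where
  "scan_body =
     (Cond (AndE (EqE (Load ''l'' (Var ''k'')) (Load ''l'' (Var ''j'')))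
             (EqE (Load ''h'' (Var ''k'')) (Load ''h'' (Var ''j''))))
       (Seq (Store ''r'' (Var ''j'') (Plus (Load ''r'' (Var ''j''))
              (OrE (LessE (Load ''x'' (Var ''k'')) (Load ''x'' (Var ''j'')))
                (AndE (EqE (Load ''x'' (Var ''k'')) (Load ''x'' (Var ''j'')))
                  (LessE (Var ''k'') (Var ''j''))))))
            (Cond (LessE (Var ''k'') (Var ''j''))
              (Seq (Store ''W'' (Var ''j'') (Load ''W'' (Var ''k''))) (Set ''g'' (Const 1)))
              Skip))
       Skip)"

definition scan_prog :: com where
  "scan_prog = For ''k'' ''n'' scan_body"

text \<open>Every job is at first treated as the first of its type, with the next free place value
  \<open>N\<close>; the scan corrects this if necessary.\<close>

definition types_prog :: com where
  "types_prog =
     Seq (Set ''N'' (Const 1))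
    (For ''j'' ''n''
      (Seq (Store ''r'' (Var ''j'') (Const 0))
      (Seq (Store ''W'' (Var ''j'') (Var ''N''))
      (Seq (Set ''g'' (Times (Plus (Var ''n'') (Const 1)) (Plus (Var ''n'') (Const 1))))
      (Seq scan_prog
        (Set ''N'' (Times (Var ''N'') (Var ''g''))))))))"

definition CoverE :: "name \<Rightarrow> expr" where
  "CoverE e = AndE
     (LessE (Load ''r'' (Var ''j''))
       (ModE (Bin Div (Var e) (Load ''W'' (Var ''j''))) (Plus (Var ''n'') (Const 1))))
     (NotE (LessE
       (Plus (Load ''r'' (Var ''j''))
         (ModE (Bin Div (Var e) (Times (Load ''W'' (Var ''j'')) (Plus (Var ''n'') (Const 1))))
           (Plus (Var ''n'') (Const 1))))
       (Var ''n'')))"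

definition NewE :: expr where
  "NewE = AndE (CoverE ''e'') (NotE (CoverE ''d''))"

definition TimeE :: "expr \<Rightarrow> expr" where
  "TimeE i = Plus (AndE (LessE i (Load ''x'' (Var ''j''))) (Load ''l'' (Var ''j'')))
     (AndE (NotE (LessE i (Load ''x'' (Var ''j'')))) (Load ''h'' (Var ''j'')))"

definition CellE :: "expr \<Rightarrow> name \<Rightarrow> expr" where
  "CellE i e = Plus (Times i (Var ''N'')) (Var e)"

definition weight_prog :: com where
  "weight_prog = Seq (Set ''s'' (Const 0))
     (For ''j'' ''n'' (Set ''s'' (Plus (Var ''s'') (AndE NewE (TimeE (Plus (Var ''i'') (Const 1)))))))"

definition update_prog :: com where
  "update_prog =
    Seq (Set ''v'' (Load ''f'' (CellE (Var ''i'') ''d'')))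
    (Seq (Cond (LessE (Var ''v'') (Var ''s'')) (Set ''v'' (Var ''s'')) Skip)
      (Cond (OrE (NotE (Var ''d''))
          (LessE (Var ''v'') (Load ''f'' (CellE (Plus (Var ''i'') (Const 1)) ''e''))))
        (Seq (Store ''f'' (CellE (Plus (Var ''i'') (Const 1)) ''e'') (Var ''v''))
          (Store ''b'' (CellE (Var ''i'') ''e'') (Var ''d'')))
        Skip))"

definition entry_prog :: com where
  "entry_prog = Seq weight_prog update_prog"

text \<open>\<open>q\<close> is the number of admissible predecessors: only state 0 in front of the
  first machine, all states afterwards.\<close>

definition table_prog :: com where
  "table_prog = Seq (Set ''q'' (Const 1))
    (For ''i'' ''c'' (Seq (For ''e'' ''N'' (For ''d'' ''q'' entry_prog)) (Set ''q'' (Var ''N''))))"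

text \<open>\<open>e\<close> is the state after machine \<open>c - k\<close> and \<open>d\<close>
  its predecessor. A job that becomes covered several times is overwritten and ends up on the lowest
  such machine; any of them would do.\<close>

definition trace_prog :: com where
  "trace_prog = Seq (Set ''e'' (Bin Sub (Var ''N'') (Const 1)))
    (For ''k'' ''c''
      (Seq (Set ''d'' (Load ''b'' (CellE (Bin Sub (Var ''c'') (Plus (Var ''k'') (Const 1))) ''e'')))
      (Seq (For ''j'' ''n''
             (Cond NewE (Store ''out'' (Var ''j'') (Bin Sub (Var ''c'') (Var ''k''))) Skip))
        (Set ''e'' (Var ''d'')))))"

definition scheduler :: com where
  "scheduler = Seq read_prog (Seq types_prog (Seq table_prog trace_prog))"

lemma mods_progs [simp]:
  "mods read_prog = {''c'', ''n'', ''D'', ''j'', ''l'', ''h'', ''x''}"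
  "mods scan_body = {''r'', ''W'', ''g''}"
  "mods scan_prog = {''k'', ''r'', ''W'', ''g''}"
  "mods types_prog = {''N'', ''j'', ''r'', ''W'', ''g'', ''k''}"
  "mods weight_prog = {''s'', ''j''}"
  "mods update_prog = {''v'', ''f'', ''b''}"
  "mods entry_prog = {''s'', ''j'', ''v'', ''f'', ''b''}"
  "mods table_prog = {''q'', ''i'', ''e'', ''d'', ''s'', ''j'', ''v'', ''f'', ''b''}"
  "mods trace_prog = {''e'', ''k'', ''d'', ''j'', ''out''}"
  by (auto simp: read_prog_def scan_body_def scan_prog_def types_prog_def weight_prog_def
      update_prog_def entry_prog_def table_prog_def trace_prog_def)

section \<open>Correctness of the program\<close>

context two_load_jobs
begin

definition has_jobs :: "state \<Rightarrow> bool" where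
  "has_jobs s \<longleftrightarrow> s ''c'' 0 = c \<and> s ''n'' 0 = n \<and>
     (\<forall>j<n. s ''l'' j = l j \<and> s ''h'' j = h j \<and> s ''x'' j = x j)"

lemma has_jobs_cong:
  assumes "has_jobs s" and "t ''c'' = s ''c''" "t ''n'' = s ''n''" "t ''l'' = s ''l''" "t ''h'' = s ''h''" "t ''x'' = s ''x''"
  shows "has_jobs t"
  using assms by (simp add: has_jobs_def)

lemma card_less_Suc_filter:
  fixes P :: "nat \<Rightarrow> bool"
  shows "card {k. k < Suc i \<and> P k} = card {k. k < i \<and> P k} + of_bool (P i)"
proof -
  have "{k. k < Suc i \<and> P k} = (if P i then insert i {k. k < i \<and> P k} else {k. k < i \<and> P k})"
    by (auto simp: less_Suc_eq)
  then show ?thesis by simp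
qed

text \<open>Symbolic execution is settled once for an arbitrary postcondition, so that
  \<open>wp_scan\<close> argues only about its invariant.\<close>

lemma wp_scan_bodyI:
  assumes vals: "t ''j'' 0 = j" "t ''k'' 0 = i" "t ''l'' i = l i" "t ''h'' i = h i" "t ''x'' i = x i"
      "t ''l'' j = l j" "t ''h'' j = h j" "t ''x'' j = x j"
    and "\<not> same i j \<Longrightarrow> Q t" and "same i j \<Longrightarrow> t ''r'' j + of_bool (before i j) \<le> 2 ^ m"
    and "same i j \<Longrightarrow> i < j \<Longrightarrow> t ''W'' i \<le> 2 ^ m"
    and "T = t(''r'' := (t ''r'')(j := t ''r'' j + of_bool (before i j)))"
    and "same i j \<Longrightarrow> i < j \<Longrightarrow>
      Q (T(''W'' := (t ''W'')(j := t ''W'' i), ''g'' := (t ''g'')(0 := 1)))"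
    and "same i j \<Longrightarrow> \<not> i < j \<Longrightarrow> Q T"
  shows "wp R m scan_body Q t"
proof -
  have b: "x i < x j \<or> x i = x j \<and> i < j \<longleftrightarrow> before i j" by (simp add: before_def)
  have s: "l i = l j \<and> h i = h j \<longleftrightarrow> same i j" by (simp add: same_def)
  have "expr_val (OrE (LessE (Load ''x'' (Var ''k'')) (Load ''x'' (Var ''j'')))
      (AndE (EqE (Load ''x'' (Var ''k'')) (Load ''x'' (Var ''j''))) (LessE (Var ''k'') (Var ''j'')))) t =
      of_bool (before i j)"
    using b by (simp add: vals)
  moreover have "expr_val (AndE (EqE (Load ''l'' (Var ''k'')) (Load ''l'' (Var ''j'')))
      (EqE (Load ''h'' (Var ''k'')) (Load ''h'' (Var ''j'')))) t = of_bool (same i j)"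
    using s by (simp add: vals flip: of_bool_conj)
  moreover have "expr_val (LessE (Var ''k'') (Var ''j'')) T = of_bool (i < j)"
    by (simp add: vals assms(12))
  moreover have "expr_val (Load ''W'' (Var ''k'')) T = t ''W'' i" "expr_val (Var ''j'') T = j" "T ''W'' = t ''W''"
      "T ''g'' = t ''g''"
    by (simp_all add: vals assms(12))
  ultimately show ?thesis
    using assms(9-) unfolding scan_body_def
    by (simp add: vals del: expr_val_logic)
qed

lemma wp_scan:
  assumes s: "has_jobs s" "s ''j'' 0 = j" "s ''r'' j = 0" "s ''W'' j = s ''N'' 0"
    "s ''g'' 0 = (n + 1) * (n + 1)"
    and j: "j < n" and pv: "place_values j (s ''W'') (s ''N'' 0)"
    and W_le: "\<And>k. k < j \<Longrightarrow> s ''W'' k \<le> 2 ^ m"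
    and R: "n \<le> R" and m: "n \<le> 2 ^ m"
  shows "wp R m scan_prog (\<lambda>t. t ''r'' j = rank j \<and> (\<forall>k. k \<noteq> j \<longrightarrow> t ''r'' k = s ''r'' k) \<and>
    place_values (Suc j) (t ''W'') (s ''N'' 0 * t ''g'' 0)) s"
proof -
  \<comment> \<open>Either an earlier job of the same type has been met, or none has and the
    provisional values still stand. The scan visits later jobs too, but these have no place value
    yet; hence \<open>k < j\<close>.\<close>
  let ?old = "\<lambda>i t. \<exists>k<i. k < j \<and> same k j \<and> t ''W'' j = s ''W'' k \<and> t ''g'' 0 = 1"
  let ?new = "\<lambda>i t. (\<forall>k<i. k < j \<longrightarrow> \<not> same k j) \<and> t ''W'' j = s ''N'' 0 \<and> t ''g'' 0 = (n + 1) * (n + 1)"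
  let ?I = "\<lambda>i t. t ''r'' j = card {k. k < i \<and> same k j \<and> before k j} \<and>
    (\<forall>k. k \<noteq> j \<longrightarrow> t ''r'' k = s ''r'' k \<and> t ''W'' k = s ''W'' k) \<and> (?old i t \<or> ?new i t)"
  show ?thesis unfolding scan_prog_def
  proof (rule wp_For [where I = ?I], goal_cases)
    case 6
    show ?case using s by simp
  next
    case (7 i t)
    have i: "i < n" using 7(1) s(1) by (simp add: has_jobs_def)
    have vals: "t ''j'' 0 = j" "t ''k'' 0 = i" "t ''l'' i = l i" "t ''h'' i = h i" "t ''x'' i = x i"
      "t ''l'' j = l j" "t ''h'' j = h j" "t ''x'' j = x j"
      using 7(3,4) s(1,2) i j by (simp_all add: has_jobs_def)
    have r: "card {k. k < i \<and> same k j \<and> before k j} + of_bool (before i j) \<le> 2 ^ m"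
    proof -
      have "card {k. k < i \<and> same k j \<and> before k j} \<le> card {..<i}" by (rule card_mono) auto
      then show ?thesis using i m by (cases "before i j") simp_all
    qed
    have W: "t ''W'' i = s ''W'' i" if "i < j" using 7(2) [THEN conjunct2, THEN conjunct1] that by simp
    note I = 7(2) [THEN conjunct1] 7(2) [THEN conjunct2, THEN conjunct1]
      and dis = 7(2) [THEN conjunct2, THEN conjunct2]
    have keep: "?I (Suc i) t" if "\<not> same i j"
      using dis
    proof
      assume "?old i t"
      then have "?old (Suc i) t" using less_SucI by blast
      with I that show ?thesis unfolding card_less_Suc_filter by simp
    next
      assume n: "?new i t"
      then have "\<forall>k<Suc i. k < j \<longrightarrow> \<not> same k j" using that by (metis less_Suc_eq)
      with n I that show ?thesis unfolding card_less_Suc_filter by simp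
    qed
    have keep': "?old (Suc i) t \<or> ?new (Suc i) t" if "\<not> i < j"
      using dis
    proof
      assume "?old i t"
      then have "?old (Suc i) t" using less_SucI by blast
      then show ?thesis ..
    next
      assume n: "?new i t"
      then have "\<forall>k<Suc i. k < j \<longrightarrow> \<not> same k j" using that by (metis less_Suc_eq)
      with n show ?thesis by blast
    qed
    define T1 where "T1 = t(''r'' := (t ''r'')(j := t ''r'' j + of_bool (before i j)))"
    define T2 where "T2 = T1(''W'' := (t ''W'')(j := t ''W'' i), ''g'' := (t ''g'')(0 := 1))"
    have skip_k: "?I (Suc i) t'' \<Longrightarrow> ?I (Suc i) (t''(''k'' := u))" for t'' u by simp
    show ?case
    proof (rule wp_scan_bodyI [OF vals _ _ _ T1_def])
      show "t ''r'' j + of_bool (before i j) \<le> 2 ^ m" using I r by simp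
    next
      assume "i < j"
      then show "t ''W'' i \<le> 2 ^ m" using W W_le by simp
    next
      assume "\<not> same i j"
      then show "?I (Suc i) (t(''k'' := (t ''k'')(0 := Suc i)))" by (intro skip_k keep)
    next
      assume "same i j" "i < j"
      have "?old (Suc i) T2" by (rule exI [of _ i]) (simp add: T2_def \<open>same i j\<close> \<open>i < j\<close> W)
      moreover have "T2 ''r'' j = card {k. k < Suc i \<and> same k j \<and> before k j}"
        using I \<open>same i j\<close> unfolding card_less_Suc_filter by (simp add: T1_def T2_def)
      moreover have "\<forall>k. k \<noteq> j \<longrightarrow> T2 ''r'' k = s ''r'' k \<and> T2 ''W'' k = s ''W'' k"
        using I by (simp add: T1_def T2_def)
      ultimately have "?I (Suc i) T2" by blast
      then show "?I (Suc i) ((T1(''W'' := (t ''W'')(j := t ''W'' i), ''g'' := (t ''g'')(0 := 1)))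
          (''k'' := ((T1(''W'' := (t ''W'')(j := t ''W'' i), ''g'' := (t ''g'')(0 := 1))) ''k'')(0 := Suc i)))"
        unfolding T2_def [symmetric] by (rule skip_k)
    next
      assume "same i j" "\<not> i < j"
      have "T1 ''r'' j = card {k. k < Suc i \<and> same k j \<and> before k j}"
        using I \<open>same i j\<close> unfolding card_less_Suc_filter by (simp add: T1_def)
      moreover have "\<forall>k. k \<noteq> j \<longrightarrow> T1 ''r'' k = s ''r'' k \<and> T1 ''W'' k = s ''W'' k"
        using I by (simp add: T1_def)
      moreover have "?old (Suc i) T1 \<or> ?new (Suc i) T1"
        using keep' [OF \<open>\<not> i < j\<close>] unfolding T1_def by simp
      ultimately have "?I (Suc i) T1" by blast
      then show "?I (Suc i) (T1(''k'' := (T1 ''k'')(0 := Suc i)))" by (rule skip_k)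
    qed
  next
    case (8 t)
    have n: "s ''n'' 0 = n" using s(1) by (simp add: has_jobs_def)
    note I = 8(1) [unfolded n, THEN conjunct1] 8(1) [THEN conjunct2, THEN conjunct1]
      and dis = 8(1) [unfolded n, THEN conjunct2, THEN conjunct2]
    have "t ''r'' j = rank j" using I(1) by (simp only: rank_def)
    moreover have "place_values (Suc j) (t ''W'') (s ''N'' 0 * t ''g'' 0)"
    proof (cases "?old n t")
      case True
      then obtain k where k: "k < j" "same k j" "t ''W'' j = s ''W'' k" "t ''g'' 0 = 1" by blast
      show ?thesis unfolding k(4) mult_1_right
        by (rule place_values_old [OF pv k(1,2), where W' = "t ''W''"]) (use I(2) k(3) in simp_all)
    next
      case False
      then have "?new n t" using dis by argo
      then have k: "\<And>k. k < j \<Longrightarrow> \<not> same k j" "t ''W'' j = s ''N'' 0" "t ''g'' 0 = (n + 1) * (n + 1)"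
        using j by auto
      show ?thesis unfolding k(3)
        by (rule place_values_new [OF pv, where W' = "t ''W''"]) (use I(2) k(1,2) in simp_all)
    qed
    ultimately show ?case using I(2) by simp
  qed (use s(1) R m in \<open>simp_all add: has_jobs_def\<close>)
qed

lemma wp_types:
  assumes s: "has_jobs s" and R: "n \<le> R" and m: "n \<le> 2 ^ m" "(n + 1) * (n + 1) \<le> 2 ^ m"
    "(n + 1) ^ (2 * num_types n) \<le> 2 ^ m"
  shows "wp R m types_prog (\<lambda>t. (\<forall>j<n. t ''r'' j = rank j) \<and> place_values n (t ''W'') (t ''N'' 0)) s"
proof -
  let ?I = "\<lambda>i t. (\<forall>j<i. t ''r'' j = rank j) \<and> place_values i (t ''W'') (t ''N'' 0)"
  \<comment> \<open>The number of types grows with the prefix of jobs, so the final number of states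
    bounds every intermediate \<open>N\<close> and \<open>W\<close>.\<close>
  have le: "(n + 1) ^ (2 * q) \<le> 2 ^ m" if "q \<le> num_types n" for q
    using order_trans [OF power_increasing m(3), of "2 * q"] that by simp
  have N_le: "N \<le> 2 ^ m" if "place_values i W N" "i \<le> n" for i W N
    using that le num_types_mono unfolding place_values_def by blast
  have W_le: "W j \<le> 2 ^ m" if pv: "place_values i W N" "i \<le> n" "j < i" for i j W N
  proof -
    obtain p where "p < num_types i" "W j = (n + 1) ^ (2 * p)"
      using pv \<open>j < i\<close> unfolding place_values_def by blast
    then show ?thesis using le [of p] num_types_mono [OF that(2)] by simp
  qed
  have n: "s ''n'' 0 = n" using s by (simp add: has_jobs_def)
  let ?s = "s(''N'' := (s ''N'')(0 := 1))"
  have "wp R m (For ''j'' ''n''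
      (Seq (Store ''r'' (Var ''j'') (Const 0))
      (Seq (Store ''W'' (Var ''j'') (Var ''N''))
      (Seq (Set ''g'' (Times (Plus (Var ''n'') (Const 1)) (Plus (Var ''n'') (Const 1))))
      (Seq scan_prog
        (Set ''N'' (Times (Var ''N'') (Var ''g'')))))))) (?I n) ?s"
  proof (rule wp_For [where I = ?I], goal_cases)
    case 6
    show ?case using place_values_0 by simp
  next
    case (7 j t)
    have j: "j < n" "t ''n'' 0 = n" using 7 n by simp_all
    let ?t = "t(''r'' := (t ''r'')(j := 0), ''W'' := (t ''W'')(j := t ''N'' 0),
      ''g'' := (t ''g'')(0 := (n + 1) * (n + 1)))"
    have jobs: "has_jobs ?t" using s by (rule has_jobs_cong) (simp_all add: 7(4))
    have pv: "place_values j (?t ''W'') (?t ''N'' 0)"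
      using 7(2) unfolding place_values_def by auto
    have "wp R m scan_prog (\<lambda>t'. t' ''r'' j = rank j \<and> (\<forall>k. k \<noteq> j \<longrightarrow> t' ''r'' k = ?t ''r'' k) \<and>
        place_values (Suc j) (t' ''W'') (?t ''N'' 0 * t' ''g'' 0)) ?t"
      by (rule wp_scan [OF jobs _ _ _ _ j(1) pv _ R m(1)])
        (use 7(3) W_le [OF pv] j in auto)
    then have "wp R m scan_prog (wp R m (Set ''N'' (Times (Var ''N'') (Var ''g'')))
        (\<lambda>t'. ?I (Suc j) (t'(''j'' := (t' ''j'')(0 := Suc j))))) ?t"
    proof (rule wp_mono, goal_cases)
      case (1 t')
      then have N: "t' ''N'' 0 = t ''N'' 0" and pv': "place_values (Suc j) (t' ''W'') (t ''N'' 0 * t' ''g'' 0)"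
        by simp_all
      show ?case
        by (rule wp_StoreI)
          (use 1 7(2) N pv' N_le [OF pv'] j in \<open>simp_all add: less_Suc_eq\<close>)
    qed
    moreover have "t ''N'' 0 \<le> 2 ^ m" using N_le [of j "t ''W''"] 7(2) j by simp
    ultimately show ?case using 7(3) j m(2) by simp
  qed (use n R m in simp_all)
  then show ?thesis unfolding types_prog_def by (simp add: n)
qed

end

section \<open>Filling the table and reading off a schedule\<close>

context two_load_states
begin

definition ready :: "state \<Rightarrow> bool" where
  "ready s \<longleftrightarrow> has_jobs s \<and> s ''N'' 0 = N \<and> (\<forall>j<n. s ''r'' j = rank j \<and> s ''W'' j = W j)"

lemma ready_cong:
  assumes "ready s" and "t ''c'' = s ''c''" "t ''n'' = s ''n''" "t ''l'' = s ''l''" "t ''h'' = s ''h''"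
    "t ''x'' = s ''x''" "t ''N'' = s ''N''" "t ''r'' = s ''r''" "t ''W'' = s ''W''"
  shows "ready t"
  using assms has_jobs_cong [of s t] by (simp add: ready_def)

lemma readyD:
  assumes "ready s"
  shows "s ''c'' 0 = c" "s ''n'' 0 = n" "s ''N'' 0 = N"
  using assms by (simp_all add: ready_def has_jobs_def)

lemma expr_val_CoverE:
  assumes "ready s" "s ''j'' 0 = j" "j < n"
  shows "expr_val (CoverE a) s = of_bool (covered (s a 0) j)"
  using assms unfolding CoverE_def ready_def has_jobs_def covered_def
  by (simp add: not_less flip: of_bool_conj)

lemma expr_val_NewE:
  assumes "ready s" "s ''j'' 0 = j" "j < n"
  shows "expr_val NewE s = of_bool (covered (s ''e'' 0) j \<and> \<not> covered (s ''d'' 0) j)"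
  unfolding NewE_def by (simp add: expr_val_CoverE [OF assms])

lemma expr_val_TimeE:
  assumes "ready s" "s ''j'' 0 = j" "j < n"
  shows "expr_val (TimeE i) s = time (expr_val i s) j"
  using assms by (simp add: TimeE_def time_def ready_def has_jobs_def)

text \<open>A weight counts each job at most once, at no more than its high load. This one sum
  therefore bounds all table values and the lengths of what is stored.\<close>

lemma weight_le: "weight i d e \<le> (\<Sum>j<n. h j)"
  unfolding weight_def
  by (rule order_trans [OF sum_mono [of _ _ h] sum_mono2]) (auto simp: time_le)

lemma wp_weight:
  assumes s: "ready s" and R: "n \<le> R" and m: "n \<le> 2 ^ m" "(\<Sum>j<n. h j) \<le> 2 ^ m"
  shows "wp R m weight_prog (\<lambda>t. t ''s'' 0 = weight (s ''i'' 0 + 1) (s ''d'' 0) (s ''e'' 0)) s"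
proof -
  \<comment> \<open>The weight restricted to the jobs below \<open>k\<close>: the value of the
    accumulator after \<open>k\<close> rounds.\<close>
  define P where "P k = (\<Sum>j | j < k \<and> covered (s ''e'' 0) j \<and> \<not> covered (s ''d'' 0) j. time (s ''i'' 0 + 1) j)" for k
  have P_Suc: "P (Suc k) = P k + of_bool (covered (s ''e'' 0) k \<and> \<not> covered (s ''d'' 0) k) * time (s ''i'' 0 + 1) k" for k
  proof -
    have "{j. j < Suc k \<and> covered (s ''e'' 0) j \<and> \<not> covered (s ''d'' 0) j} =
      (if covered (s ''e'' 0) k \<and> \<not> covered (s ''d'' 0) k then insert k else id)
        {j. j < k \<and> covered (s ''e'' 0) j \<and> \<not> covered (s ''d'' 0) j}"
      by (auto simp: less_Suc_eq)
    then show ?thesis by (simp add: P_def)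
  qed
  have P_mono: "P (Suc k) \<le> P n" if "k < n" for k
    unfolding P_def by (rule sum_mono2) (use that in auto)
  have P_le: "P n \<le> 2 ^ m" using weight_le m(2) order_trans unfolding P_def weight_def by blast
  let ?s = "s(''s'' := (s ''s'')(0 := 0))"
  let ?b = "Set ''s'' (Plus (Var ''s'') (AndE NewE (TimeE (Plus (Var ''i'') (Const 1)))))"
  have "wp R m (For ''j'' ''n'' ?b) (\<lambda>t. t ''s'' 0 = P n) ?s"
  proof (rule wp_For [where I = "\<lambda>k t. t ''s'' 0 = P k"], goal_cases)
    case 6
    show ?case by (simp add: P_def)
  next
    case (7 k t)
    have k: "k < n" using 7(1) readyD [OF s] by simp
    have t: "ready t" using s by (rule ready_cong) (simp_all add: 7(4))
    have v: "expr_val (Plus (Var ''s'') (AndE NewE (TimeE (Plus (Var ''i'') (Const 1))))) t = P (Suc k)"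
      using expr_val_NewE [OF t 7(3) k] expr_val_TimeE [OF t 7(3) k] by (simp add: 7(2,4) P_Suc)
    show ?case
      by (rule wp_StoreI, unfold v) (use P_mono [OF k] P_le in simp_all)
  qed (use readyD [OF s] R m in simp_all)
  then show ?thesis unfolding weight_prog_def by (simp add: P_def weight_def)
qed

abbreviation table :: "name \<Rightarrow> state \<Rightarrow> nat \<Rightarrow> nat \<Rightarrow> nat" where
  "table a s i e \<equiv> s a (i * N + e)"

text \<open>Row-major addressing: with columns below \<open>N\<close>, quotient and remainder
  recover the cell.\<close>

lemma cell_eq_iff:
  assumes "e < N" "e' < N"
  shows "i * N + e = i' * N + e' \<longleftrightarrow> i = i' \<and> e = e'"
proof
  assume *: "i * N + e = i' * N + e'"
  from arg_cong [OF *, of "\<lambda>y. y div N"] arg_cong [OF *, of "\<lambda>y. y mod N"] assms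
  show "i = i' \<and> e = e'" by simp
qed simp

lemma wp_updateI:
  assumes t: "ready t" and i: "t ''i'' 0 = i" "t ''e'' 0 = e" "t ''d'' 0 = d"
    and v: "v = max (t ''s'' 0) (table ''f'' t i d)" and le: "v \<le> 2 ^ m" "d \<le> 2 ^ m"
    and T: "T = t(''v'' := (t ''v'')(0 := v))"
    and Q: "d = 0 \<or> v < table ''f'' t (Suc i) e \<Longrightarrow>
        Q (T(''f'' := (t ''f'')(Suc i * N + e := v), ''b'' := (t ''b'')(i * N + e := d)))"
      "\<not> (d = 0 \<or> v < table ''f'' t (Suc i) e) \<Longrightarrow> Q T"
  shows "wp R m update_prog Q t"
proof -
  let ?f = "table ''f'' t i d"
  have f: "?f \<le> 2 ^ m" "t ''s'' 0 \<le> 2 ^ m" using v le by auto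
  let ?T0 = "t(''v'' := (t ''v'')(0 := ?f))"
  have N: "t ''N'' 0 = N" using readyD [OF t] by simp
  let ?C = "Cond (OrE (NotE (Var ''d''))
          (LessE (Var ''v'') (Load ''f'' (CellE (Plus (Var ''i'') (Const 1)) ''e''))))
        (Seq (Store ''f'' (CellE (Plus (Var ''i'') (Const 1)) ''e'') (Var ''v''))
          (Store ''b'' (CellE (Var ''i'') ''e'') (Var ''d'')))
        Skip"
  have C: "wp R m ?C Q T"
    using Q le by (simp add: T i N CellE_def)
  define G where "G = wp R m ?C Q"
  have G: "G T" using C unfolding G_def .
  have "wp R m (Cond (LessE (Var ''v'') (Var ''s'')) (Set ''v'' (Var ''s'')) Skip) G ?T0"
    using G [unfolded T v] f by (cases "?f < t ''s'' 0") (simp_all add: max_def split: if_splits)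
  then have "wp R m (Set ''v'' (Load ''f'' (CellE (Var ''i'') ''d'')))
      (wp R m (Cond (LessE (Var ''v'') (Var ''s'')) (Set ''v'' (Var ''s'')) Skip) G) t"
    by (intro wp_StoreI) (use f in \<open>simp_all add: CellE_def i N del: wp.simps\<close>)
  then show ?thesis unfolding update_prog_def G_def wp.simps(3) .
qed

text \<open>The premise \<open>entry\<close> is restricted to \<open>0 < d\<close> because
  \<open>table_entry 0\<close> is unsatisfiable: it asks for a predecessor below 0. At
  \<open>d = 0\<close> the unconditional write establishes the entry for the single candidate
  0.\<close>

lemma wp_entry:
  assumes s: "ready s" and i: "s ''i'' 0 = i" "s ''e'' 0 = e" "s ''d'' 0 = d" "e < N" "d < N"
    and entry: "0 < d \<Longrightarrow> table_entry d i e (table ''f'' s) (table ''b'' s)"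
    and f: "\<And>y. s ''f'' y \<le> (\<Sum>j<n. h j)"
    and R: "n \<le> R" and m: "n \<le> 2 ^ m" "(\<Sum>j<n. h j) \<le> 2 ^ m" "N \<le> 2 ^ m"
  shows "wp R m entry_prog (\<lambda>t. table_entry (Suc d) i e (table ''f'' t) (table ''b'' t) \<and>
    (\<forall>y. t ''f'' y \<le> (\<Sum>j<n. h j)) \<and>
    (\<forall>y. y \<noteq> Suc i * N + e \<longrightarrow> t ''f'' y = s ''f'' y) \<and>
    (\<forall>y. y \<noteq> i * N + e \<longrightarrow> t ''b'' y = s ''b'' y)) s" (is "wp R m _ ?Q s")
proof -
  have "wp R m weight_prog (wp R m update_prog ?Q) s"
  proof (rule wp_mono [OF wp_weight [OF s R m(1,2)]])
    fix t assume t: "t ''s'' 0 = weight (s ''i'' 0 + 1) (s ''d'' 0) (s ''e'' 0)"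
      "\<forall>a. a \<notin> mods weight_prog \<longrightarrow> t a = s a"
    have eq: "t ''f'' = s ''f''" "t ''b'' = s ''b''" by (simp_all add: t(2))
    have rt: "ready t" using s by (rule ready_cong) (simp_all add: t(2))
    have ti: "t ''i'' 0 = i" "t ''e'' 0 = e" "t ''d'' 0 = d" using i by (simp_all add: t(2))
    define v where "v = max (t ''s'' 0) (table ''f'' t i d)"
    define T where "T = t(''v'' := (t ''v'')(0 := v))"
    have w: "t ''s'' 0 = weight (Suc i) d e" using t(1) i by simp
    have v_le: "v \<le> (\<Sum>j<n. h j)" unfolding v_def w eq using f weight_le by simp
    \<comment> \<open>The minimum is written to row \<open>Suc i\<close>, so the row
      \<open>i\<close> from which it is taken stays intact.\<close>
    have cells: "Suc i * N + e \<noteq> i * N + d'" if "d' < N" for d'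
      using cell_eq_iff [OF i(4) that] by (metis n_not_Suc_n)
    show "wp R m update_prog ?Q t"
    proof (rule wp_updateI [OF rt ti v_def _ _ T_def])
      show "v \<le> 2 ^ m" using v_le m(2) by simp
      show "d \<le> 2 ^ m" using i(5) m(3) by simp
    next
      let ?T = "T(''f'' := (t ''f'')(Suc i * N + e := v), ''b'' := (t ''b'')(i * N + e := d))"
      assume d: "d = 0 \<or> v < table ''f'' t (Suc i) e"
      have Tf: "?T ''f'' = (s ''f'')(Suc i * N + e := v)" and Tb: "?T ''b'' = (s ''b'')(i * N + e := d)"
        by (simp_all add: eq)
      have F: "table ''f'' ?T (Suc i) e = v" "table ''b'' ?T i e = d"
        "\<And>d'. d' < N \<Longrightarrow> table ''f'' ?T i d' = table ''f'' s i d'"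
        unfolding Tf Tb by (simp_all only: fun_upd_same fun_upd_other [OF cells [symmetric]])
      have "v \<le> max (weight (Suc i) d' e) (table ''f'' s i d')" if "d' < Suc d" for d'
      proof (cases "d' = d")
        case True
        then show ?thesis by (simp add: v_def w eq)
      next
        case False
        then have "d' < d" "0 < d" using that by simp_all
        then have "table ''f'' s (Suc i) e \<le> max (weight (Suc i) d' e) (table ''f'' s i d')"
          using entry unfolding table_entry_def by blast
        moreover have "v < table ''f'' s (Suc i) e" using d \<open>0 < d\<close> unfolding eq by simp
        ultimately show ?thesis by linarith
      qed
      moreover have "v = max (weight (Suc i) d e) (table ''f'' s i d)" by (simp add: v_def w eq)
      moreover have "d' < N" if "d' < Suc d" for d' using that i(5) by simp
      ultimately have "table_entry (Suc d) i e (table ''f'' ?T) (table ''b'' ?T)"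
        unfolding table_entry_def F(1,2) using F(3) i(5) by (metis lessI)
      moreover have "\<forall>y. ?T ''f'' y \<le> (\<Sum>j<n. h j)" unfolding Tf using f v_le by simp
      moreover have "\<forall>y. y \<noteq> Suc i * N + e \<longrightarrow> ?T ''f'' y = s ''f'' y"
        "\<forall>y. y \<noteq> i * N + e \<longrightarrow> ?T ''b'' y = s ''b'' y"
        unfolding Tf Tb by (blast intro: fun_upd_other)+
      ultimately show "?Q ?T" by blast
    next
      assume d: "\<not> (d = 0 \<or> v < table ''f'' t (Suc i) e)"
      have F: "T ''f'' = s ''f''" "T ''b'' = s ''b''" by (simp_all add: T_def eq)
      have e: "table_entry d i e (table ''f'' s) (table ''b'' s)" using d entry by simp
      have "table ''f'' s (Suc i) e \<le> max (weight (Suc i) d e) (table ''f'' s i d)"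
        using d not_less unfolding v_def w eq by blast
      with e have "table_entry (Suc d) i e (table ''f'' s) (table ''b'' s)"
        unfolding table_entry_def by (metis less_Suc_eq)
      then show "?Q T" unfolding F using f by blast
    qed
  qed
  then show ?thesis unfolding entry_prog_def wp.simps(3) .
qed

lemma wp_row_entry:
  assumes s: "ready s" and i: "s ''i'' 0 = i" "s ''e'' 0 = e" "s ''q'' 0 = q" "e < N" "0 < q" "q \<le> N"
    and f: "\<And>y. s ''f'' y \<le> (\<Sum>j<n. h j)"
    and R: "n \<le> R" "N \<le> R" and m: "n \<le> 2 ^ m" "(\<Sum>j<n. h j) \<le> 2 ^ m" "N \<le> 2 ^ m"
  shows "wp R m (For ''d'' ''q'' entry_prog) (\<lambda>t. table_entry q i e (table ''f'' t) (table ''b'' t) \<and>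
    (\<forall>y. t ''f'' y \<le> (\<Sum>j<n. h j)) \<and>
    (\<forall>y. y \<noteq> Suc i * N + e \<longrightarrow> t ''f'' y = s ''f'' y) \<and>
    (\<forall>y. y \<noteq> i * N + e \<longrightarrow> t ''b'' y = s ''b'' y)) s"
proof -
  let ?Q = "\<lambda>t. (\<forall>y. t ''f'' y \<le> (\<Sum>j<n. h j)) \<and>
    (\<forall>y. y \<noteq> Suc i * N + e \<longrightarrow> t ''f'' y = s ''f'' y) \<and>
    (\<forall>y. y \<noteq> i * N + e \<longrightarrow> t ''b'' y = s ''b'' y)"
  let ?E = "\<lambda>d t. table_entry d i e (table ''f'' t) (table ''b'' t)"
  show ?thesis
  proof (rule wp_For [where I = "\<lambda>d t. (0 < d \<longrightarrow> ?E d t) \<and> ?Q t"], goal_cases)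
    case 6
    show ?case using f by simp
  next
    case (7 d t)
    have t: "ready t" using s by (rule ready_cong) (simp_all add: 7(4))
    have d: "d < N" using 7(1) i by simp
    have ti: "t ''i'' 0 = i" "t ''e'' 0 = e" using i by (simp_all add: 7(4))
    note E = 7(2) [THEN conjunct1] and f_le = 7(2) [THEN conjunct2, THEN conjunct1]
      and f_eq = 7(2) [THEN conjunct2, THEN conjunct2, THEN conjunct1]
      and b_eq = 7(2) [THEN conjunct2, THEN conjunct2, THEN conjunct2]
    show ?case
    proof (rule wp_mono [OF wp_entry [OF t ti 7(3) i(4) d _ _ R(1) m]], goal_cases)
      case 1
      then show ?case by (rule E [THEN mp])
    next
      case 2
      show ?case by (rule f_le [THEN spec])
    next
      case (3 t')
      note E' = 3(1) [THEN conjunct1] and f_le' = 3(1) [THEN conjunct2, THEN conjunct1]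
        and f_eq' = 3(1) [THEN conjunct2, THEN conjunct2, THEN conjunct1]
        and b_eq' = 3(1) [THEN conjunct2, THEN conjunct2, THEN conjunct2]
      have "\<forall>y. y \<noteq> Suc i * N + e \<longrightarrow> t' ''f'' y = s ''f'' y"
      proof (intro allI impI)
        fix y assume y: "y \<noteq> Suc i * N + e"
        show "t' ''f'' y = s ''f'' y"
          using f_eq' [rule_format, OF y] f_eq [rule_format, OF y] by (rule trans)
      qed
      moreover have "\<forall>y. y \<noteq> i * N + e \<longrightarrow> t' ''b'' y = s ''b'' y"
      proof (intro allI impI)
        fix y assume y: "y \<noteq> i * N + e"
        show "t' ''b'' y = s ''b'' y"
          using b_eq' [rule_format, OF y] b_eq [rule_format, OF y] by (rule trans)
      qed
      ultimately have I': "(0 < Suc d \<longrightarrow> ?E (Suc d) t') \<and> ?Q t'" using E' f_le' by blast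
      have upd: "(t'(''d'' := u)) ''f'' = t' ''f''" "(t'(''d'' := u)) ''b'' = t' ''b''" for u by simp_all
      show ?case unfolding upd using I' .
    qed
  next
    case (8 t)
    show ?case using 8(1) [unfolded i(3)] i(5) by blast
  qed (use i R m in simp_all)
qed

lemma wp_row:
  assumes s: "ready s" and i: "s ''i'' 0 = i" "s ''q'' 0 = q" "0 < q" "q \<le> N"
    and f: "\<And>y. s ''f'' y \<le> (\<Sum>j<n. h j)"
    and R: "n \<le> R" "N \<le> R" and m: "n \<le> 2 ^ m" "(\<Sum>j<n. h j) \<le> 2 ^ m" "N \<le> 2 ^ m"
  shows "wp R m (For ''e'' ''N'' (For ''d'' ''q'' entry_prog)) (\<lambda>t.
    (\<forall>e<N. table_entry q i e (table ''f'' t) (table ''b'' t)) \<and>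
    (\<forall>y. t ''f'' y \<le> (\<Sum>j<n. h j)) \<and>
    (\<forall>i'\<le>i. \<forall>e<N. table ''f'' t i' e = table ''f'' s i' e) \<and>
    (\<forall>i'<i. \<forall>e<N. table ''b'' t i' e = table ''b'' s i' e)) s"
proof -
  let ?Q = "\<lambda>t. (\<forall>y. t ''f'' y \<le> (\<Sum>j<n. h j)) \<and>
    (\<forall>i'\<le>i. \<forall>e<N. table ''f'' t i' e = table ''f'' s i' e) \<and>
    (\<forall>i'<i. \<forall>e<N. table ''b'' t i' e = table ''b'' s i' e)"
  let ?E = "\<lambda>e t. table_entry q i e (table ''f'' t) (table ''b'' t)"
  let ?I = "\<lambda>e t. (\<forall>e'<e. ?E e' t) \<and> ?Q t"
  have N: "s ''N'' 0 = N" using readyD [OF s] by simp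
  show ?thesis
  proof (rule wp_For [where I = ?I], goal_cases)
    case 6
    show ?case using f by simp
  next
    case (7 e t)
    have t: "ready t" using s by (rule ready_cong) (simp_all add: 7(4))
    have e: "e < N" using 7(1) N by simp
    have ti: "t ''i'' 0 = i" "t ''q'' 0 = q" using i by (simp_all add: 7(4))
    have E: "\<forall>e'<e. ?E e' t" and Q: "?Q t" using 7(2) by blast+
    show ?case
    proof (rule wp_mono [OF wp_row_entry [OF t ti(1) 7(3) ti(2) e i(3,4) _ R m]], goal_cases)
      case (1 y)
      show ?case using Q by blast
    next
      case (2 t')
      have fb: "table ''f'' t' i' e' = table ''f'' t i' e'" if "e' < N" "i' \<noteq> Suc i \<or> e' \<noteq> e" for i' e'
        using 2(1) cell_eq_iff [OF that(1) e, of i' "Suc i"] that(2) by blast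
      have bb: "table ''b'' t' i' e' = table ''b'' t i' e'" if "e' < N" "i' \<noteq> i \<or> e' \<noteq> e" for i' e'
        using 2(1) cell_eq_iff [OF that(1) e, of i' i] that(2) by blast
      have "?E e' t'" if "e' < Suc e" for e'
      proof (cases "e' = e")
        case True
        then show ?thesis using 2(1) by blast
      next
        case False
        then have "e' < e" "e' < N" using that e by simp_all
        then have "?E e' t' \<longleftrightarrow> ?E e' t"
          by (intro table_entry_cong fb bb) (use False i(4) in simp_all)
        then show ?thesis using E \<open>e' < e\<close> by blast
      qed
      moreover have "\<forall>i'\<le>i. \<forall>e'<N. table ''f'' t' i' e' = table ''f'' s i' e'"
      proof (intro allI impI)
        fix i' e' assume "i' \<le> i" "e' < N"
        then show "table ''f'' t' i' e' = table ''f'' s i' e'" using fb [of e' i'] Q by fastforce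
      qed
      moreover have "\<forall>i'<i. \<forall>e'<N. table ''b'' t' i' e' = table ''b'' s i' e'"
      proof (intro allI impI)
        fix i' e' assume "i' < i" "e' < N"
        then show "table ''b'' t' i' e' = table ''b'' s i' e'" using bb [of e' i'] Q by fastforce
      qed
      moreover have "\<forall>y. t' ''f'' y \<le> (\<Sum>j<n. h j)" using 2(1) by blast
      ultimately have I': "?I (Suc e) t'" by blast
      have upd: "(t'(''e'' := u)) ''f'' = t' ''f''" "(t'(''e'' := u)) ''b'' = t' ''b''" for u by simp_all
      show ?case unfolding upd using I' .
    qed
  next
    case (8 t)
    then show ?case unfolding N by blast
  qed (use N R m in simp_all)
qed

lemma wp_table:
  assumes s: "ready s" and f: "\<And>y. s ''f'' y = 0"
    and R: "n \<le> R" "N \<le> R" "c \<le> R" and m: "n \<le> 2 ^ m" "(\<Sum>j<n. h j) \<le> 2 ^ m" "N \<le> 2 ^ m" "c \<le> 2 ^ m"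
  shows "wp R m table_prog (\<lambda>t. optimal_table (table ''f'' t) (table ''b'' t)) s"
proof -
  let ?q = "\<lambda>i. if i = 0 then 1 else N"
  let ?E = "\<lambda>i e t. table_entry (?q i) i e (table ''f'' t) (table ''b'' t)"
  let ?I = "\<lambda>i t. t ''q'' 0 = ?q i \<and> table ''f'' t 0 0 = 0 \<and> (\<forall>y. t ''f'' y \<le> (\<Sum>j<n. h j)) \<and>
    (\<forall>i'<i. \<forall>e<N. ?E i' e t)"
  let ?s = "s(''q'' := (s ''q'')(0 := 1))"
  have q: "0 < ?q i" "?q i \<le> N" for i using N_pos by simp_all
  have "wp R m (For ''i'' ''c'' (Seq (For ''e'' ''N'' (For ''d'' ''q'' entry_prog)) (Set ''q'' (Var ''N''))))
    (\<lambda>t. optimal_table (table ''f'' t) (table ''b'' t)) ?s"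
  proof (rule wp_For [where I = ?I], goal_cases)
    case 6
    show ?case using f by simp
  next
    case (7 i t)
    have t: "ready t" using s by (rule ready_cong) (simp_all add: 7(4))
    have I: "t ''q'' 0 = ?q i" "table ''f'' t 0 0 = 0" "\<And>y. t ''f'' y \<le> (\<Sum>j<n. h j)"
      "\<forall>i'<i. \<forall>e<N. ?E i' e t" using 7(2) by blast+
    have "wp R m (For ''e'' ''N'' (For ''d'' ''q'' entry_prog)) (wp R m (Set ''q'' (Var ''N''))
        (\<lambda>t'. ?I (Suc i) (t'(''i'' := (t' ''i'')(0 := Suc i))))) t"
    proof (rule wp_mono [OF wp_row [OF t 7(3) I(1) q I(3) R(1,2) m(1-3)]])
      fix t' assume post: "(\<forall>e<N. ?E i e t') \<and> (\<forall>y. t' ''f'' y \<le> (\<Sum>j<n. h j)) \<and>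
          (\<forall>i'\<le>i. \<forall>e<N. table ''f'' t' i' e = table ''f'' t i' e) \<and>
          (\<forall>i'<i. \<forall>e<N. table ''b'' t' i' e = table ''b'' t i' e)"
        and fr: "\<forall>a. a \<notin> mods (For ''e'' ''N'' (For ''d'' ''q'' entry_prog)) \<longrightarrow> t' a = t a"
      have N: "t' ''N'' 0 = N" using readyD [OF t] by (simp add: fr)
      have "?E i' e t'" if "i' < Suc i" "e < N" for i' e
      proof (cases "i' = i")
        case True
        then show ?thesis using post that by blast
      next
        case False
        then have "i' < i" using that by simp
        have "?E i' e t' \<longleftrightarrow> ?E i' e t"
        proof (rule table_entry_cong)
          fix d assume "d < ?q i'"
          then have "d < N" using q(2) [of i'] by simp
          then show "table ''f'' t' i' d = table ''f'' t i' d" using post \<open>i' < i\<close> less_imp_le by blast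
        qed (use post \<open>i' < i\<close> that(2) Suc_leI in blast)+
        then show ?thesis using I(4) \<open>i' < i\<close> that(2) by blast
      qed
      moreover have "table ''f'' t' 0 0 = 0" using post I(2) N_pos le0 by metis
      ultimately have I': "table ''f'' t' 0 0 = 0 \<and> (\<forall>y. t' ''f'' y \<le> (\<Sum>j<n. h j)) \<and> (\<forall>i'<Suc i. \<forall>e<N. ?E i' e t')"
        using post by blast
      let ?t = "t'(''q'' := (t' ''q'')(0 := N), ''i'' := (t' ''i'')(0 := Suc i))"
      have eq: "?t ''f'' = t' ''f''" "?t ''b'' = t' ''b''" "?t ''q'' 0 = ?q (Suc i)" by simp_all
      have "?I (Suc i) ?t" unfolding eq using I' by blast
      then have I_t: "?I (Suc i) ?t" .
      have ev: "expr_val (Var ''N'') t' = N" using N by simp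
      show "wp R m (Set ''q'' (Var ''N'')) (\<lambda>t'. ?I (Suc i) (t'(''i'' := (t' ''i'')(0 := Suc i)))) t'"
      proof (rule wp_StoreI, goal_cases)
        case 1
        show ?case unfolding ev using m(3) .
      next
        case 2
        have i_eq: "(t'(''q'' := (t' ''q'')(0 := N))) ''i'' = t' ''i''" by simp
        show ?case unfolding ev expr_val.simps(1) i_eq using I_t .
      qed
    qed
    then show ?case by (simp only: wp.simps(3))
  next
    case (8 t)
    have c: "?s ''c'' 0 = c" using readyD(1) [OF s] by simp
    have "table ''f'' t 0 0 = 0" by (rule 8(1) [THEN conjunct2, THEN conjunct1])
    moreover have "\<forall>i'<c. \<forall>e<N. ?E i' e t"
      using 8(1) [unfolded c, THEN conjunct2, THEN conjunct2, THEN conjunct2] .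
    ultimately show ?case unfolding optimal_table_def by (rule conjI)
  qed (use readyD [OF s] R m in simp_all)
  then have body: "wp R m (For ''i'' ''c'' (Seq (For ''e'' ''N'' (For ''d'' ''q'' entry_prog)) (Set ''q'' (Var ''N''))))
    (\<lambda>t. optimal_table (table ''f'' t) (table ''b'' t)) ?s" .
  show ?thesis unfolding table_prog_def wp.simps(3)
  proof (rule wp_StoreI, goal_cases)
    case 1
    show ?case by simp
  next
    case 2
    show ?case unfolding expr_val.simps(1) using body .
  qed
qed

declare trace.simps(2) [simp del]

lemma wp_trace:
  assumes s: "ready s" and opt: "optimal_table (table ''f'' s) (table ''b'' s)"
    and R: "n \<le> R" "c \<le> R" and m: "n \<le> 2 ^ m" "N \<le> 2 ^ m" "c \<le> 2 ^ m"
  shows "wp R m trace_prog (\<lambda>t. \<forall>j<n. \<exists>k<c. t ''out'' j = c - k \<and>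
    covered (trace (table ''b'' s) k) j \<and> \<not> covered (trace (table ''b'' s) (Suc k)) j) s"
proof -
  let ?tr = "trace (table ''b'' s)"
  let ?O = "\<lambda>k j u. \<exists>k'<k. u = c - k' \<and> covered (?tr k') j \<and> \<not> covered (?tr (Suc k')) j"
  \<comment> \<open>On the way back, a job leaves the covered set only in a step that assigns it.
    All jobs are covered at \<open>N - 1\<close> and none at 0, so all are assigned in the
    end.\<close>
  let ?I = "\<lambda>k t. t ''e'' 0 = ?tr k \<and> (\<forall>j<n. covered (?tr k) j \<or> ?O k j (t ''out'' j))"
  let ?s = "s(''e'' := (s ''e'')(0 := N - 1))"
  let ?inner = "Cond NewE (Store ''out'' (Var ''j'') (Bin Sub (Var ''c'') (Var ''k''))) Skip"
  let ?body = "Seq (Set ''d'' (Load ''b'' (CellE (Bin Sub (Var ''c'') (Plus (Var ''k'') (Const 1))) ''e'')))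
      (Seq (For ''j'' ''n'' ?inner) (Set ''e'' (Var ''d'')))"
  have "wp R m (For ''k'' ''c'' ?body) (\<lambda>t. \<forall>j<n. ?O c j (t ''out'' j)) ?s"
  proof (rule wp_For [where I = ?I], goal_cases)
    case 6
    show ?case using covered_last by simp
  next
    case (7 k t)
    have k: "k < c" using 7(1) readyD [OF s] by simp
    have t: "ready t" using s by (rule ready_cong) (simp_all add: 7(4))
    have I: "t ''e'' 0 = ?tr k" "\<And>j. j < n \<Longrightarrow> covered (?tr k) j \<or> ?O k j (t ''out'' j)"
      using 7(2) by blast+
    have d: "expr_val (Load ''b'' (CellE (Bin Sub (Var ''c'') (Plus (Var ''k'') (Const 1))) ''e'')) t = ?tr (Suc k)"
      using readyD [OF t] by (simp add: CellE_def I(1) 7(3,4) trace.simps(2))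
    have "?tr (Suc k) < N" using trace_less [OF opt, of "Suc k"] k by simp
    then have d_le: "?tr (Suc k) \<le> 2 ^ m" using m(2) by linarith
    let ?t = "t(''d'' := (t ''d'')(0 := ?tr (Suc k)))"
    \<comment> \<open>The untouched rest of \<open>out\<close> is recorded so that the outer
      invariant can still be used for jobs not yet visited.\<close>
    let ?J = "\<lambda>i t'. (\<forall>j<i. covered (?tr (Suc k)) j \<or> ?O (Suc k) j (t' ''out'' j)) \<and>
      (\<forall>j. i \<le> j \<longrightarrow> t' ''out'' j = t ''out'' j)"
    have "wp R m (For ''j'' ''n'' ?inner) (\<lambda>t'. \<forall>j<n. covered (?tr (Suc k)) j \<or> ?O (Suc k) j (t' ''out'' j)) ?t"
    proof (rule wp_For [where I = ?J], goal_cases)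
      case 6
      show ?case by simp
    next
      case (7 j t')
      have j: "j < n" using 7(1) readyD [OF t] by simp
      have t': "ready t'" using t by (rule ready_cong) (simp_all add: 7(4))
      have new: "expr_val NewE t' = of_bool (covered (?tr k) j \<and> \<not> covered (?tr (Suc k)) j)"
        using expr_val_NewE [OF t' 7(3) j] by (simp add: 7(4) I(1))
      have v: "t' ''c'' 0 = c" "t' ''k'' 0 = k" using readyD [OF t'] \<open>t ''k'' 0 = k\<close> by (simp_all add: 7(4))
      have J: "\<And>j'. j' < j \<Longrightarrow> covered (?tr (Suc k)) j' \<or> ?O (Suc k) j' (t' ''out'' j')"
        "\<And>j'. j \<le> j' \<Longrightarrow> t' ''out'' j' = t ''out'' j'" using 7(2) by blast+
      have J': "?J (Suc j) (t''(''j'' := u))" if "\<And>j'. j' \<noteq> j \<Longrightarrow> t'' ''out'' j' = t' ''out'' j'"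
        "covered (?tr (Suc k)) j \<or> ?O (Suc k) j (t'' ''out'' j)" for t'' u
      proof -
        have "covered (?tr (Suc k)) j' \<or> ?O (Suc k) j' (t'' ''out'' j')" if "j' < Suc j" for j'
          using J(1) [of j'] that \<open>\<And>j'. j' \<noteq> j \<Longrightarrow> t'' ''out'' j' = t' ''out'' j'\<close> [of j']
            \<open>covered (?tr (Suc k)) j \<or> ?O (Suc k) j (t'' ''out'' j)\<close>
          by (cases "j' = j") (simp_all only: less_Suc_eq simp_thms)
        moreover have "t'' ''out'' j' = t ''out'' j'" if "Suc j \<le> j'" for j'
          using J(2) [of j'] that \<open>\<And>j'. j' \<noteq> j \<Longrightarrow> t'' ''out'' j' = t' ''out'' j'\<close> [of j'] by simp
        moreover have "(t''(''j'' := u)) ''out'' = t'' ''out''" by simp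
        ultimately show ?thesis by metis
      qed
      show ?case
      proof (cases "covered (?tr k) j \<and> \<not> covered (?tr (Suc k)) j")
        case True
        then have nz: "expr_val NewE t' \<noteq> 0" unfolding new by simp
        have O: "?O (Suc k) j (c - k)" using True by (intro exI [of _ k]) simp
        define T where "T = t'(''out'' := (t' ''out'')(j := c - k))"
        have T: "?J (Suc j) (T(''j'' := (T ''j'')(0 := Suc j)))"
        proof (rule J')
          have "T ''out'' j = c - k" by (simp add: T_def)
          with O show "covered (?tr (Suc k)) j \<or> ?O (Suc k) j (T ''out'' j)" by metis
        qed (simp add: T_def)
        have ev: "expr_val (Var ''j'') t' = j" "expr_val (Bin Sub (Var ''c'') (Var ''k'')) t' = c - k"
          using v 7(3) by simp_all
        have "wp R m (Store ''out'' (Var ''j'') (Bin Sub (Var ''c'') (Var ''k'')))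
          (\<lambda>t'. ?J (Suc j) (t'(''j'' := (t' ''j'')(0 := Suc j)))) t'"
        proof (rule wp_StoreI, goal_cases)
          case 1
          show ?case unfolding ev using m(3) by simp
        next
          case 2
          show ?case unfolding ev using T unfolding T_def .
        qed
        then show ?thesis using nz by (simp only: wp.simps(4) if_True simp_thms)
      next
        case False
        then have z: "expr_val NewE t' = 0" unfolding new by simp
        have "?J (Suc j) (t'(''j'' := (t' ''j'')(0 := Suc j)))"
        proof (rule J')
          show "covered (?tr (Suc k)) j \<or> ?O (Suc k) j (t' ''out'' j)"
          proof (cases "covered (?tr (Suc k)) j")
            case True
            then show ?thesis ..
          next
            \<comment> \<open>The job is not covered at \<open>?tr k\<close> either, so a previous
              round has assigned it, and this round leaves its cell alone.\<close>
            case not: False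
            then have "\<not> covered (?tr k) j" using False by blast
            then have "?O k j (t' ''out'' j)" using I(2) [OF j] J(2) [OF order_refl] by (simp only: simp_thms)
            then have "?O (Suc k) j (t' ''out'' j)" using less_SucI by blast
            then show ?thesis ..
          qed
        qed simp
        then show ?thesis using z by (simp only: wp.simps(1,4) if_False simp_thms)
      qed
    next
      case (8 t')
      have "?t ''n'' 0 = n" using readyD(2) [OF t] by simp
      then show ?case using 8(1) [THEN conjunct1] by (simp only:)
    qed (use readyD [OF t] R m in simp_all)
    then have "wp R m (For ''j'' ''n'' ?inner) (wp R m (Set ''e'' (Var ''d''))
        (\<lambda>t'. ?I (Suc k) (t'(''k'' := (t' ''k'')(0 := Suc k))))) ?t"
    proof (rule wp_mono)
      fix t' assume out: "\<forall>j<n. covered (?tr (Suc k)) j \<or> ?O (Suc k) j (t' ''out'' j)"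
        and fr: "\<forall>a. a \<notin> mods (For ''j'' ''n'' ?inner) \<longrightarrow> t' a = ?t a"
      have ev: "expr_val (Var ''d'') t' = ?tr (Suc k)" by (simp add: fr)
      let ?u = "t'(''e'' := (t' ''e'')(0 := ?tr (Suc k)))"
      have "(?u(''k'' := (?u ''k'')(0 := Suc k))) ''e'' 0 = ?tr (Suc k)"
        "(?u(''k'' := (?u ''k'')(0 := Suc k))) ''out'' = t' ''out''" by (simp_all)
      then have I': "?I (Suc k) (?u(''k'' := (?u ''k'')(0 := Suc k)))" using out by (simp only: simp_thms)
      show "wp R m (Set ''e'' (Var ''d'')) (\<lambda>t'. ?I (Suc k) (t'(''k'' := (t' ''k'')(0 := Suc k)))) t'"
      proof (rule wp_StoreI, goal_cases)
        case 1
        show ?case unfolding ev using d_le .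
      next
        case 2
        show ?case unfolding ev expr_val.simps(1) using I' .
      qed
    qed
    then have wp_t: "wp R m (For ''j'' ''n'' ?inner) (wp R m (Set ''e'' (Var ''d''))
        (\<lambda>t'. ?I (Suc k) (t'(''k'' := (t' ''k'')(0 := Suc k))))) ?t" .
    have "wp R m (Set ''d'' (Load ''b'' (CellE (Bin Sub (Var ''c'') (Plus (Var ''k'') (Const 1))) ''e'')))
        (wp R m (For ''j'' ''n'' ?inner) (wp R m (Set ''e'' (Var ''d''))
        (\<lambda>t'. ?I (Suc k) (t'(''k'' := (t' ''k'')(0 := Suc k)))))) t"
    proof (rule wp_StoreI, goal_cases)
      case 1
      show ?case unfolding d using d_le .
    next
      case 2
      show ?case unfolding d expr_val.simps(1) using wp_t .
    qed
    then show ?case by (simp only: wp.simps(3))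
  next
    case (8 t)
    have "?tr c = 0" using trace_end [OF opt] .
    moreover have "?s ''c'' 0 = c" using readyD(1) [OF s] by simp
    ultimately show ?case using 8(1) not_covered_0 by metis
  qed (use readyD [OF s] R m in simp_all)
  then have body: "wp R m (For ''k'' ''c'' ?body) (\<lambda>t. \<forall>j<n. ?O c j (t ''out'' j)) ?s" .
  have ev: "expr_val (Bin Sub (Var ''N'') (Const 1)) s = N - 1" using readyD(3) [OF s] by simp
  show ?thesis unfolding trace_prog_def wp.simps(3)
  proof (rule wp_StoreI, goal_cases)
    case 1
    show ?case unfolding ev using m(2) by simp
  next
    case 2
    show ?case unfolding ev expr_val.simps(1) using body .
  qed
qed

end

section \<open>Reading the input, and the composed program\<close>

lemma wp_read:
  fixes ln ld hn hd xx :: "nat \<Rightarrow> nat"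
  assumes s: "s ''in'' 0 = c" "s ''in'' 1 = n"
    and job: "\<And>j. j < n \<Longrightarrow> s ''in'' (5 * j + 2) = ln j \<and> s ''in'' (5 * j + 3) = ld j \<and>
      s ''in'' (5 * j + 4) = hn j \<and> s ''in'' (5 * j + 5) = hd j \<and> s ''in'' (5 * j + 6) = xx j"
    and D: "D = (\<Prod>j<n. ld j * hd j)"
    and pos: "\<And>j. j < n \<Longrightarrow> 0 < ld j \<and> 0 < hd j"
    and R: "n \<le> R" and m: "c \<le> 2 ^ m" "n \<le> 2 ^ m" "D \<le> 2 ^ m"
    and job_m: "\<And>j. j < n \<Longrightarrow> ln j * D \<le> 2 ^ m \<and> hn j * D \<le> 2 ^ m \<and> xx j \<le> 2 ^ m"
  shows "wp R m read_prog (\<lambda>t. t ''c'' 0 = c \<and> t ''n'' 0 = n \<and>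
    (\<forall>j<n. t ''l'' j = ln j * D div ld j \<and> t ''h'' j = hn j * D div hd j \<and> t ''x'' j = xx j)) s"
proof -
  let ?in = "\<lambda>r. Load ''in'' (Plus (Times (Const 5) (Var ''j'')) (Const r))"
  let ?A = "Set ''D'' (Times (Var ''D'') (Times (?in 3) (?in 5)))"
  let ?l = "Bin Div (Times (?in 2) (Var ''D'')) (?in 3)"
  let ?h = "Bin Div (Times (?in 4) (Var ''D'')) (?in 5)"
  let ?B = "Seq (Store ''l'' (Var ''j'') ?l) (Seq (Store ''h'' (Var ''j'') ?h)
    (Store ''x'' (Var ''j'') (?in 6)))"
  let ?s = "s(''c'' := (s ''c'')(0 := c), ''n'' := (s ''n'')(0 := n), ''D'' := (s ''D'')(0 := 1))"
  let ?Q = "\<lambda>i t. \<forall>j<i. t ''l'' j = ln j * D div ld j \<and> t ''h'' j = hn j * D div hd j \<and> t ''x'' j = xx j"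
  \<comment> \<open>A partial product divides the positive \<open>D\<close>, so no intermediate
    value of the loop is longer than the final one.\<close>
  have partial: "(\<Prod>j<i. ld j * hd j) \<le> D" if "i \<le> n" for i
  proof -
    have "(\<Prod>j<i. ld j * hd j) dvd D" unfolding D using that by (intro prod_dvd_prod_subset) auto
    moreover have "0 < D" unfolding D using pos by (intro prod_pos) auto
    ultimately show ?thesis by (rule dvd_imp_le)
  qed
  have second: "wp R m (For ''j'' ''n'' ?B) (?Q n) t"
    if t: "t ''D'' 0 = D" "t ''n'' 0 = n" "t ''in'' = s ''in''" for t
  proof (rule wp_For [where I = ?Q], goal_cases)
    case (7 j u)
    have j: "j < n" using 7(1) t by simp
    have u: "u ''D'' 0 = D" "u ''in'' = s ''in''" using t by (simp_all add: 7(4))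
    note Q = 7(2)
    note jb = job [OF j]
    have ev: "expr_val (Var ''j'') v = j" "expr_val ?l v = ln j * D div ld j"
      "expr_val ?h v = hn j * D div hd j" "expr_val (?in 6) v = xx j"
      if "v ''D'' 0 = D" "v ''in'' = s ''in''" "v ''j'' 0 = j" for v
      using jb that by simp_all
    have le: "ln j * D div ld j \<le> 2 ^ m" "hn j * D div hd j \<le> 2 ^ m" "xx j \<le> 2 ^ m"
      using job_m [OF j] by (meson div_le_dividend le_trans)+
    let ?v1 = "u(''l'' := (u ''l'')(j := ln j * D div ld j))"
    let ?v2 = "?v1(''h'' := (u ''h'')(j := hn j * D div hd j))"
    let ?v3 = "?v2(''x'' := (u ''x'')(j := xx j))"
    have Q3: "?Q (Suc j) (?v3(''j'' := w))" for w
    proof (intro allI impI)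
      fix i assume "i < Suc j"
      then show "(?v3(''j'' := w)) ''l'' i = ln i * D div ld i \<and> (?v3(''j'' := w)) ''h'' i = hn i * D div hd i \<and>
          (?v3(''j'' := w)) ''x'' i = xx i"
        using Q [rule_format, of i] by (cases "i = j") simp_all
    qed
    have e1: "expr_val (Var ''j'') u = j" "expr_val ?l u = ln j * D div ld j"
      and e2: "expr_val (Var ''j'') ?v1 = j" "expr_val ?h ?v1 = hn j * D div hd j"
      and e3: "expr_val (Var ''j'') ?v2 = j" "expr_val (?in 6) ?v2 = xx j"
      and e4: "?v1 ''h'' = u ''h''" "?v2 ''x'' = u ''x''"
      using u 7(3) by (intro ev; simp; fail)+ simp_all
    show ?case unfolding wp.simps(2,3) e1 e4 e2 e3 using le Q3 by blast
  qed (use t R m in simp_all)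
  have first: "wp R m (For ''j'' ''n'' ?A) (\<lambda>t. t ''D'' 0 = D) ?s"
  proof (rule wp_For [where I = "\<lambda>i t. t ''D'' 0 = (\<Prod>j<i. ld j * hd j)"], goal_cases)
    case (7 j u)
    have j: "j < n" using 7(1) by simp
    have u: "u ''in'' = s ''in''" by (simp add: 7(4))
    have ev: "expr_val (Times (Var ''D'') (Times (?in 3) (?in 5))) u = (\<Prod>j<Suc j. ld j * hd j)"
      using job [OF j] by (simp add: u 7(2,3))
    show ?case
    proof (rule wp_StoreI, goal_cases)
      case 1
      show ?case unfolding ev using partial [of "Suc j"] j m(3) by simp
    next
      case 2
      show ?case unfolding ev by simp
    qed
  qed (use R m D in simp_all)
  have "wp R m (For ''j'' ''n'' ?A) (wp R m (For ''j'' ''n'' ?B) (\<lambda>t. t ''c'' 0 = c \<and> t ''n'' 0 = n \<and> ?Q n t)) ?s"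
  proof (rule wp_mono [OF first])
    fix t assume t: "t ''D'' 0 = D" "\<forall>a. a \<notin> mods (For ''j'' ''n'' ?A) \<longrightarrow> t a = ?s a"
    have v: "t ''n'' 0 = n" "t ''in'' = s ''in''" "t ''c'' 0 = c" by (simp_all add: t(2))
    show "wp R m (For ''j'' ''n'' ?B) (\<lambda>t. t ''c'' 0 = c \<and> t ''n'' 0 = n \<and> ?Q n t) t"
    proof (rule wp_mono [OF second [OF t(1) v(1,2)]])
      fix u assume u: "?Q n u" "\<forall>a. a \<notin> mods (For ''j'' ''n'' ?B) \<longrightarrow> u a = t a"
      have "u ''c'' 0 = c" "u ''n'' 0 = n" using v by (simp_all add: u(2))
      with u(1) show "u ''c'' 0 = c \<and> u ''n'' 0 = n \<and> ?Q n u" by blast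
    qed
  qed
  then show ?thesis unfolding read_prog_def using s m by simp
qed

lemma wp_scheduler:
  assumes jobs: "two_load_jobs c n l h"
    and read: "wp R m read_prog (\<lambda>t. t ''c'' 0 = c \<and> t ''n'' 0 = n \<and>
      (\<forall>j<n. t ''l'' j = l j \<and> t ''h'' j = h j \<and> t ''x'' j = x j)) s"
    and f: "\<And>y. s ''f'' y = 0"
    and types: "card ((\<lambda>j. (l j, h j)) ` {..<n}) \<le> K"
    and R: "n \<le> R" "c \<le> R" "(n + 1) ^ (2 * K) \<le> R"
    and m: "n \<le> 2 ^ m" "c \<le> 2 ^ m" "(n + 1) ^ (2 * K) \<le> 2 ^ m" "(n + 1) * (n + 1) \<le> 2 ^ m"
      "(\<Sum>j<n. h j) \<le> 2 ^ m"
  shows "wp R m scheduler (\<lambda>t. (\<forall>j<n. t ''out'' j \<in> {1..c}) \<and>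
    (\<forall>a T. (\<forall>j<n. a j \<in> {1..c}) \<longrightarrow> (\<forall>i\<in>{1..c}. two_load_jobs.load n l h x a i \<le> T) \<longrightarrow>
      (\<forall>i\<in>{1..c}. two_load_jobs.load n l h x (t ''out'') i \<le> T))) s" (is "wp R m _ ?Q s")
proof -
  interpret two_load_jobs c n l h x by (rule jobs)
  have K: "(n + 1) ^ (2 * num_types n) \<le> (n + 1) ^ (2 * K)"
    using types unfolding num_types_def by (intro power_increasing) simp_all
  show ?thesis unfolding scheduler_def wp.simps(3)
  proof (rule wp_mono [OF read])
    fix t1 assume t1: "t1 ''c'' 0 = c \<and> t1 ''n'' 0 = n \<and>
        (\<forall>j<n. t1 ''l'' j = l j \<and> t1 ''h'' j = h j \<and> t1 ''x'' j = x j)"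
      and fr1: "\<forall>a. a \<notin> mods read_prog \<longrightarrow> t1 a = s a"
    have j1: "has_jobs t1" using t1 unfolding has_jobs_def .
    show "wp R m types_prog (wp R m table_prog (wp R m trace_prog ?Q)) t1"
    proof (rule wp_mono [OF wp_types [OF j1 R(1) m(1,4) order_trans [OF K m(3)]]])
      fix t2 assume t2: "(\<forall>j<n. t2 ''r'' j = rank j) \<and> place_values n (t2 ''W'') (t2 ''N'' 0)"
        and fr2: "\<forall>a. a \<notin> mods types_prog \<longrightarrow> t2 a = t1 a"
      \<comment> \<open>The place values are whatever the program has found: the locale is entered
        with memory contents as parameters.\<close>
      interpret two_load_states c n l h x "t2 ''W''" "t2 ''N'' 0"
        by unfold_locales (use t2 in blast)
      have "has_jobs t2" using j1 by (rule has_jobs_cong) (simp_all add: fr2)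
      then have r2: "ready t2" unfolding ready_def using t2 by blast
      have N: "t2 ''N'' 0 \<le> (n + 1) ^ (2 * K)" using t2 K unfolding place_values_def by simp
      have f2: "t2 ''f'' y = 0" for y using f by (simp add: fr1 fr2)
      show "wp R m table_prog (wp R m trace_prog ?Q) t2"
      proof (rule wp_mono [OF wp_table [OF r2 f2 R(1) order_trans [OF N R(3)] R(2) m(1,5)
            order_trans [OF N m(3)] m(2)]])
        fix t3 assume t3: "optimal_table (table ''f'' t3) (table ''b'' t3)"
          and fr3: "\<forall>a. a \<notin> mods table_prog \<longrightarrow> t3 a = t2 a"
        have r3: "ready t3" using r2 by (rule ready_cong) (simp_all add: fr3)
        show "wp R m trace_prog ?Q t3"
        proof (rule wp_mono [OF wp_trace [OF r3 t3 R(1,2) m(1) order_trans [OF N m(3)] m(2)]])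
          fix t4 assume t4: "\<forall>j<n. \<exists>k<c. t4 ''out'' j = c - k \<and>
            covered (trace (table ''b'' t3) k) j \<and> \<not> covered (trace (table ''b'' t3) (Suc k)) j"
          have "t4 ''out'' j \<in> {1..c}" if "j < n" for j
          proof -
            from t4 that obtain k where "k < c" "t4 ''out'' j = c - k" by blast
            then show ?thesis by simp
          qed
          moreover have "load (t4 ''out'') i \<le> T"
            if "\<forall>j<n. a j \<in> {1..c}" "\<forall>i\<in>{1..c}. load a i \<le> T" "i \<in> {1..c}" for a T i
            by (rule trace_assignment_optimal [OF t3 _ that]) (use t4 in blast)
          ultimately show "?Q t4" by blast
        qed
      qed
    qed
  qed
qed

section \<open>Encoded instances\<close>

definition num :: "rat \<Rightarrow> nat" where "num r = nat (fst (quotient_of r))"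
definition den :: "rat \<Rightarrow> nat" where "den r = nat (snd (quotient_of r))"

lemma den_pos: "0 < den r"
  using quotient_of_denom_pos' [of r] by (simp add: den_def)

lemma num_den:
  assumes "0 \<le> r"
  shows "of_nat (num r) = r * of_nat (den r)"
proof -
  obtain a b where ab: "quotient_of r = (a, b)" by fastforce
  then have "0 < b" "r = of_int a / of_int b" using quotient_of_denom_pos quotient_of_div by blast+
  moreover from this assms have "0 \<le> a" by (simp add: zero_le_divide_iff)
  moreover have "num r = nat a" "den r = nat b" by (simp_all add: num_def den_def ab)
  ultimately show ?thesis by simp
qed

lemma encode_job_eq: "encode_job q = [num (low q), den (low q), num (high q), den (high q), idx q]"
  by (simp add: encode_job_def encode_rat_def num_def den_def)

lemma length_concat_encode: "length (concat (map encode_job js)) = 5 * length js"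
  by (induction js) (simp_all add: encode_job_eq)

lemma concat_encode_nth:
  assumes "j < length js" and "r < 5"
  shows "concat (map encode_job js) ! (5 * j + r) = encode_job (js ! j) ! r"
  using assms(1)
proof (induction js arbitrary: j)
  case (Cons q js)
  have len: "length (encode_job q) = 5" by (simp add: encode_job_eq)
  show ?case
  proof (cases j)
    case 0
    then show ?thesis using len assms(2) by (simp add: nth_append)
  next
    case (Suc j')
    then have "5 * j + r = length (encode_job q) + (5 * j' + r)" using len by simp
    then show ?thesis using Cons Suc by (simp only: list.map concat.simps nth_append_length_plus) simp
  qed
qed simp

lemma initial_state_job:
  assumes "j < length (jobs I)" and "r < 5"
  shows "initial_state I ''in'' (5 * j + (2 + r)) = encode_job (jobs I ! j) ! r"
proof -
  have "5 * j + (2 + r) < length (encode I)"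
    using assms by (simp add: encode_def length_concat_encode)
  moreover have "encode I ! (5 * j + (2 + r)) = concat (map encode_job (jobs I)) ! (5 * j + r)"
    by (simp add: encode_def)
  ultimately show ?thesis using concat_encode_nth [OF assms] by (simp add: initial_state_def)
qed

lemma le_two_power_bits: "v \<le> 2 ^ bits v"
proof (cases "v = 0")
  case False
  then have "v < 2 ^ floorlog 2 v" using floorlog_bounds [of v 2] by simp
  also have "\<dots> \<le> 2 ^ bits v" by (intro power_increasing) (simp_all add: bits_def)
  finally show ?thesis by simp
qed simp

lemma encode_le:
  assumes "v \<in> set (encode I)"
  shows "v \<le> 2 ^ input_size I"
proof -
  have "bits v \<le> sum_list (map bits (encode I))"
    using assms by (intro member_le_sum_list) auto
  then have "bits v \<le> input_size I" by (simp add: input_size_def)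
  then have "(2::nat) ^ bits v \<le> 2 ^ input_size I" by (intro power_increasing) simp_all
  with le_two_power_bits [of v] show ?thesis by (rule order_trans)
qed

lemma initial_state_le: "initial_state I a i \<le> 2 ^ input_size I"
  using encode_le [of "encode I ! i" I] by (simp add: initial_state_def)

lemma length_le_sum_bits: "length vs \<le> sum_list (map bits vs)"
  by (induction vs) (simp_all add: bits_def)

lemma input_size_ge: "machines I + 5 * length (jobs I) + 2 \<le> input_size I"
  using length_le_sum_bits [of "encode I"]
  by (simp add: input_size_def encode_def length_concat_encode)

text \<open>Lengths of factors add up in a product, and each denominator occurs in the
  input.\<close>

lemma prod_den_le: "(\<Prod>j<length js. den (low (js ! j)) * den (high (js ! j))) \<le>
    2 ^ sum_list (map bits (concat (map encode_job js)))"
proof (induction js)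
  case (Cons q js)
  let ?d = "\<lambda>q. den (low q) * den (high q)"
  have "?d q \<le> 2 ^ bits (den (low q)) * 2 ^ bits (den (high q))"
    by (intro mult_le_mono le_two_power_bits)
  also have "\<dots> = 2 ^ (bits (den (low q)) + bits (den (high q)))" by (simp add: power_add)
  also have "\<dots> \<le> 2 ^ sum_list (map bits (encode_job q))"
    by (intro power_increasing) (simp_all add: encode_job_eq)
  finally have q: "?d q \<le> 2 ^ sum_list (map bits (encode_job q))" .
  have "(\<Prod>j<length (q # js). ?d ((q # js) ! j)) = ?d q * (\<Prod>j<length js. ?d (js ! j))"
    by (simp add: prod.lessThan_Suc_shift del: prod.lessThan_Suc)
  also have "\<dots> \<le> 2 ^ sum_list (map bits (encode_job q)) * 2 ^ sum_list (map bits (concat (map encode_job js)))"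
    by (rule mult_le_mono [OF q Cons.IH])
  finally show ?case by (simp add: power_add)
qed simp

section \<open>Scaling by a common denominator\<close>

definition common_den :: "inst \<Rightarrow> nat" where
  "common_den I = (\<Prod>j<length (jobs I). den (low (jobs I ! j)) * den (high (jobs I ! j)))"

lemma common_den_pos: "0 < common_den I"
  unfolding common_den_def by (intro prod_pos) (simp add: den_pos)

lemma common_den_le: "common_den I \<le> 2 ^ input_size I"
proof -
  have "(2::nat) ^ sum_list (map bits (concat (map encode_job (jobs I)))) \<le> 2 ^ input_size I"
    by (intro power_increasing) (simp_all add: input_size_def encode_def)
  then show ?thesis using prod_den_le [of "jobs I"] unfolding common_den_def by linarith
qed

text \<open>Multiplying before dividing matches what \<open>read_prog\<close> computes; for the
  loads of the instance the division is exact.\<close>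

definition scaled :: "inst \<Rightarrow> rat \<Rightarrow> nat" where
  "scaled I r = num r * common_den I div den r"

lemma of_nat_scaled:
  assumes "0 \<le> r" and "den r dvd common_den I"
  shows "of_nat (scaled I r) = r * of_nat (common_den I)"
proof -
  obtain b where b: "common_den I = den r * b" using assms(2) by (rule dvdE)
  then have "scaled I r = num r * b" using den_pos [of r] by (simp add: scaled_def)
  then show ?thesis using num_den [OF assms(1)] by (simp add: b)
qed

lemma den_dvd_common_den:
  assumes "j < length (jobs I)"
  shows "den (low (jobs I ! j)) dvd common_den I" "den (high (jobs I ! j)) dvd common_den I"
proof -
  have "den (low (jobs I ! j)) * den (high (jobs I ! j)) dvd common_den I"
    unfolding common_den_def using assms by (intro dvd_prodI) auto
  then show "den (low (jobs I ! j)) dvd common_den I" "den (high (jobs I ! j)) dvd common_den I"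
    by (blast intro: dvd_mult_left dvd_mult_right)+
qed

section \<open>Transfer to a given instance\<close>

context
  fixes I :: inst
  assumes valid: "valid_inst I"
begin

abbreviation (input) "C \<equiv> machines I"
abbreviation (input) "J \<equiv> length (jobs I)"
abbreviation (input) "L \<equiv> \<lambda>j. scaled I (low (jobs I ! j))"
abbreviation (input) "Hi \<equiv> \<lambda>j. scaled I (high (jobs I ! j))"
abbreviation (input) "X \<equiv> \<lambda>j. idx (jobs I ! j)"

lemma valid_jobs:
  assumes "j < J"
  shows "0 \<le> low (jobs I ! j)" "low (jobs I ! j) \<le> high (jobs I ! j)" "0 \<le> high (jobs I ! j)"
proof -
  have "valid_job C (jobs I ! j)" using valid assms by (simp add: valid_inst_def)
  then show "0 \<le> low (jobs I ! j)" "low (jobs I ! j) \<le> high (jobs I ! j)" "0 \<le> high (jobs I ! j)"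
    by (simp_all add: valid_job_def)
qed

lemma of_nat_scaled_jobs:
  assumes "j < J"
  shows "of_nat (L j) = low (jobs I ! j) * of_nat (common_den I)"
    "of_nat (Hi j) = high (jobs I ! j) * of_nat (common_den I)"
  using of_nat_scaled valid_jobs [OF assms] den_dvd_common_den [OF assms] by blast+

lemma two_load_jobs_scaled: "two_load_jobs C J L Hi"
proof
  show "1 \<le> C" using valid by (simp add: valid_inst_def)
next
  fix j assume j: "j < J"
  have "(of_nat (L j) :: rat) \<le> of_nat (Hi j)"
    unfolding of_nat_scaled_jobs [OF j] using valid_jobs [OF j] by (intro mult_right_mono) simp_all
  then show "L j \<le> Hi j" by simp
qed

interpretation two_load_jobs C J L Hi X
  by (rule two_load_jobs_scaled)

text \<open>All loads are multiplied by the same positive number, so comparisons carry over between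
  rationals and natural numbers.\<close>

lemma of_nat_load:
  "(of_nat (load a i) :: rat) = (\<Sum>j\<in>{j. j < J \<and> a j = i}. run_time I i j) * of_nat (common_den I)"
  unfolding load_def of_nat_sum sum_distrib_right
  by (rule sum.cong) (auto simp: time_def run_time_def Let_def of_nat_scaled_jobs)

lemma load_optimal_imp_optimal_assignment:
  assumes out: "\<forall>j<J. out j \<in> {1..C}"
    and opt: "\<And>a T. \<forall>j<J. a j \<in> {1..C} \<Longrightarrow> \<forall>i\<in>{1..C}. load a i \<le> T \<Longrightarrow> \<forall>i\<in>{1..C}. load out i \<le> T"
  shows "optimal_assignment C J (run_time I) out"
  unfolding optimal_assignment_def
proof (intro conjI allI impI)
  show "is_assignment C J out" using out by (simp add: is_assignment_def)
next
  fix b assume "is_assignment C J b"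
  then have b: "\<forall>j<J. b j \<in> {1..C}" by (simp add: is_assignment_def)
  have ne: "{1..C} \<noteq> {}" using c_pos by simp
  let ?l = "\<lambda>a i. \<Sum>j\<in>{j. j < J \<and> a j = i}. run_time I i j"
  \<comment> \<open>\<open>T\<close> will be the largest scaled load of \<open>b\<close>. It is
    attained on a machine \<open>i'\<close>, so the bound is itself a load and can be scaled
    back.\<close>
  have "Max (load b ` {1..C}) \<in> load b ` {1..C}" by (rule Max_in) (use ne in simp_all)
  then obtain i' where i': "i' \<in> {1..C}" "Max (load b ` {1..C}) = load b i'" by blast
  have "\<forall>i\<in>{1..C}. load b i \<le> load b i'"
    unfolding i'(2) [symmetric] by (intro ballI Max_ge) simp_all
  then have load_le: "\<forall>i\<in>{1..C}. load out i \<le> load b i'" by (rule opt [OF b])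
  have le: "?l out i \<le> ?l b i'" if "i \<in> {1..C}" for i
  proof -
    have "(of_nat (load out i) :: rat) \<le> of_nat (load b i')"
      using load_le that unfolding of_nat_le_iff by blast
    then show ?thesis unfolding of_nat_load using common_den_pos by (simp add: mult_le_cancel_right)
  qed
  have "makespan C J (run_time I) out \<le> ?l b i'"
    unfolding makespan_def by (rule Max.boundedI) (use ne le in auto)
  also have "\<dots> \<le> makespan C J (run_time I) b"
    unfolding makespan_def by (rule Max_ge) (use i' in auto)
  finally show "makespan C J (run_time I) out \<le> makespan C J (run_time I) b" .
qed

text \<open>Scaling is a function of the load alone, so it cannot create new types.\<close>

lemma num_types_le:
  assumes "card (low_loads I) \<le> k" "card (high_loads I) \<le> k"
  shows "card ((\<lambda>j. (L j, Hi j)) ` {..<J}) \<le> k * k"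
proof -
  let ?T = "(\<lambda>(u, v). (scaled I u, scaled I v)) ` (low_loads I \<times> high_loads I)"
  have fin: "finite (low_loads I \<times> high_loads I)" by (simp add: low_loads_def high_loads_def)
  have "(\<lambda>j. (L j, Hi j)) ` {..<J} \<subseteq> ?T"
    by (force simp: low_loads_def high_loads_def)
  then have "card ((\<lambda>j. (L j, Hi j)) ` {..<J}) \<le> card ?T"
    using fin by (intro card_mono) simp_all
  also have "\<dots> \<le> card (low_loads I \<times> high_loads I)" using fin by (rule card_image_le)
  also have "\<dots> \<le> k * k" unfolding card_cartesian_product using assms by (rule mult_le_mono)
  finally show ?thesis .
qed

text \<open>\<open>R\<close> has room for the states and, by its second summand, for the jobs and
  machines. In \<open>m\<close>, the multiple 2 k^2 of the input size suffices for state numbers,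
  and 3 for the sum of loads, bounded by a product of the job count, a numerator and the common
  denominator.\<close>

lemma wp_scheduler_instance:
  assumes k: "card (low_loads I) \<le> k" "card (high_loads I) \<le> k"
    and R: "R = input_size I ^ (2 * (k * k)) + input_size I" and m: "m = input_size I * (2 * (k * k) + 3)"
  shows "wp R m scheduler (\<lambda>t. optimal_assignment C J (run_time I) (computed_assignment t)) (initial_state I)"
proof -
  let ?S = "input_size I" and ?s = "initial_state I"
  have S: "C + 5 * J + 2 \<le> ?S" by (rule input_size_ge)
  have pow: "(2::nat) ^ (?S * r) \<le> 2 ^ m" if "r \<le> 2 * (k * k) + 3" for r
    unfolding m using that by (intro power_increasing mult_le_mono2) simp_all
  have S_le: "?S \<le> 2 ^ ?S" by (simp add: less_imp_le)
  have S_m: "(2::nat) ^ ?S \<le> 2 ^ m" using pow [of 1] by simp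
  have two: "u * v \<le> 2 ^ m" if "u \<le> 2 ^ ?S" "v \<le> 2 ^ ?S" for u v :: nat
  proof -
    have "u * v \<le> 2 ^ ?S * 2 ^ ?S" using that by (rule mult_le_mono)
    also have "\<dots> = 2 ^ (?S * 2)" by (simp only: mult_2_right power_add)
    finally show ?thesis using pow [of 2] by linarith
  qed
  have in_le: "v \<le> 2 ^ ?S" if "v \<in> set (encode_job (jobs I ! j))" "j < J" for v j
    by (rule encode_le) (use that in \<open>auto simp: encode_def\<close>)
  have nums: "num (low (jobs I ! j)) \<le> 2 ^ ?S" "num (high (jobs I ! j)) \<le> 2 ^ ?S" "X j \<le> 2 ^ ?S"
    if "j < J" for j using in_le [OF _ that] by (simp_all add: encode_job_eq)
  have Hi_le: "Hi j \<le> 2 ^ ?S * 2 ^ ?S" if "j < J" for j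
  proof -
    have "Hi j \<le> num (high (jobs I ! j)) * common_den I" by (simp add: scaled_def)
    also have "\<dots> \<le> 2 ^ ?S * 2 ^ ?S" using nums(2) [OF that] common_den_le by (rule mult_le_mono)
    finally show ?thesis .
  qed
  have sum_le: "(\<Sum>j<J. Hi j) \<le> 2 ^ m"
  proof -
    have "(\<Sum>j<J. Hi j) \<le> (\<Sum>j<J. 2 ^ ?S * 2 ^ ?S)" by (intro sum_mono Hi_le) simp
    also have "\<dots> = J * (2 ^ ?S * 2 ^ ?S)" by simp
    also have "\<dots> \<le> 2 ^ ?S * (2 ^ ?S * 2 ^ ?S)" using S S_le by (intro mult_le_mono1) linarith
    also have "\<dots> = 2 ^ (?S * 3)" by (simp add: power_mult power3_eq_cube power_mult_distrib)
    finally show ?thesis using pow [of 3] by linarith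
  qed
  have n1: "J + 1 \<le> ?S" using S by simp
  have power_R: "(J + 1) ^ (2 * (k * k)) \<le> ?S ^ (2 * (k * k))" using n1 by (rule power_mono) simp
  have power_m: "(J + 1) ^ (2 * (k * k)) \<le> 2 ^ m"
  proof -
    have "(J + 1) ^ (2 * (k * k)) \<le> (2 ^ ?S) ^ (2 * (k * k))"
      using n1 S_le by (intro power_mono) linarith+
    also have "\<dots> = 2 ^ (?S * (2 * (k * k)))" by (simp add: power_mult)
    finally show ?thesis using pow [of "2 * (k * k)"] by linarith
  qed
  have input: "?s ''in'' 0 = C" "?s ''in'' 1 = J"
    by (simp_all add: initial_state_def encode_def)
  have job: "?s ''in'' (5 * j + 2) = num (low (jobs I ! j)) \<and> ?s ''in'' (5 * j + 3) = den (low (jobs I ! j)) \<and>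
      ?s ''in'' (5 * j + 4) = num (high (jobs I ! j)) \<and> ?s ''in'' (5 * j + 5) = den (high (jobs I ! j)) \<and>
      ?s ''in'' (5 * j + 6) = X j" if "j < J" for j
    using initial_state_job [OF that, of 0] initial_state_job [OF that, of 1] initial_state_job [OF that, of 2]
      initial_state_job [OF that, of 3] initial_state_job [OF that, of 4] by (simp add: encode_job_eq)
  have read: "wp R m read_prog (\<lambda>t. t ''c'' 0 = C \<and> t ''n'' 0 = J \<and>
      (\<forall>j<J. t ''l'' j = L j \<and> t ''h'' j = Hi j \<and> t ''x'' j = X j)) ?s"
    unfolding scaled_def
  proof (rule wp_read [where ln = "\<lambda>j. num (low (jobs I ! j))" and ld = "\<lambda>j. den (low (jobs I ! j))"
        and hn = "\<lambda>j. num (high (jobs I ! j))" and hd = "\<lambda>j. den (high (jobs I ! j))" and xx = X and D = "common_den I"])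
    show "?s ''in'' 0 = C" "?s ''in'' 1 = J" by (rule input)+
    show "common_den I = (\<Prod>j<J. den (low (jobs I ! j)) * den (high (jobs I ! j)))" by (rule common_den_def)
    show "C \<le> 2 ^ m" "J \<le> 2 ^ m" "common_den I \<le> 2 ^ m" "J \<le> R"
      using S S_le S_m common_den_le [of I] unfolding R by linarith+
  next
    fix j assume j: "j < J"
    show "?s ''in'' (5 * j + 2) = num (low (jobs I ! j)) \<and> ?s ''in'' (5 * j + 3) = den (low (jobs I ! j)) \<and>
      ?s ''in'' (5 * j + 4) = num (high (jobs I ! j)) \<and> ?s ''in'' (5 * j + 5) = den (high (jobs I ! j)) \<and>
      ?s ''in'' (5 * j + 6) = X j" by (rule job [OF j])
    show "num (low (jobs I ! j)) * common_den I \<le> 2 ^ m \<and> num (high (jobs I ! j)) * common_den I \<le> 2 ^ m \<and> X j \<le> 2 ^ m"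
      using nums(1,2) [OF j] common_den_le [of I] order_trans [OF nums(3) [OF j] S_m]
      by (intro conjI two)
  qed (simp_all add: den_pos)
  show ?thesis
  proof (rule wp_mono [OF wp_scheduler [OF two_load_jobs_scaled read _ num_types_le [OF k]]])
    show "?s ''f'' y = 0" for y by (simp add: initial_state_def)
  next
    show "J \<le> R" "C \<le> R" using S unfolding R by linarith+
    show "J \<le> 2 ^ m" "C \<le> 2 ^ m" using S S_le S_m by linarith+
    show "(J + 1) ^ (2 * (k * k)) \<le> R" using power_R unfolding R by simp
    show "(J + 1) * (J + 1) \<le> 2 ^ m" using n1 S_le by (intro two) linarith+
  next
    fix t
    assume t: "(\<forall>j<J. t ''out'' j \<in> {1..C}) \<and>
      (\<forall>a T. (\<forall>j<J. a j \<in> {1..C}) \<longrightarrow> (\<forall>i\<in>{1..C}. load a i \<le> T) \<longrightarrow> (\<forall>i\<in>{1..C}. load (t ''out'') i \<le> T))"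
    have "computed_assignment t = t ''out''" by (rule ext) (simp add: computed_assignment_def)
    moreover have "optimal_assignment C J (run_time I) (t ''out'')"
      by (rule load_optimal_imp_optimal_assignment) (use t in blast)+
    ultimately show "optimal_assignment C J (run_time I) (computed_assignment t)" by (simp only:)
  qed (fact power_m sum_le)+
qed

end

theorem theorem11:
  fixes k :: nat
  shows "\<exists>(A :: com) (p :: nat poly). \<forall>I :: inst.
           valid_inst I \<and> card (low_loads I) \<le> k \<and> card (high_loads I) \<le> k \<longrightarrow>
           (\<exists>t s. exec A (initial_state I) t s \<and>
                  t \<le> poly p (input_size I) \<and>
                  optimal_assignment (machines I) (length (jobs I)) (run_time I) (computed_assignment s))"
proof -
  \<comment> \<open>\<open>[:0, 1:]\<close> is the indeterminate; evaluated at the input size,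
    \<open>?r\<close> and \<open>?q\<close> are the \<open>R\<close> and \<open>m\<close> of
    \<open>wp_scheduler_instance\<close>.\<close>
  let ?r = "[:0, 1:] ^ (2 * (k * k)) + [:0, 1:] :: nat poly" and ?q = "[:0, 2 * (k * k) + 3:] :: nat poly"
  obtain p where p: "\<And>S. cost_bound (poly ?r S) (poly ?q S) scheduler = poly p S"
    using cost_bound_poly [of ?r ?q scheduler] by blast
  have "\<exists>t s. exec scheduler (initial_state I) t s \<and> t \<le> poly p (input_size I) \<and>
      optimal_assignment (machines I) (length (jobs I)) (run_time I) (computed_assignment s)"
    if I: "valid_inst I" and k: "card (low_loads I) \<le> k" "card (high_loads I) \<le> k" for I
  proof -
    let ?R = "input_size I ^ (2 * (k * k)) + input_size I" and ?m = "input_size I * (2 * (k * k) + 3)"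
    have "2 \<le> input_size I" using input_size_ge [of I] by simp
    then have m: "input_size I \<le> ?m" "1 \<le> ?m" by simp_all
    have le: "\<forall>a i. initial_state I a i \<le> 2 ^ ?m"
      using order_trans [OF initial_state_le power_increasing [OF m(1)]] by simp
    have "poly ?r (input_size I) = ?R" "poly ?q (input_size I) = ?m" by (simp_all add: poly_power)
    then have "cost_bound ?R ?m scheduler = poly p (input_size I)" using p by metis
    with wp_exec [OF m(2) le wp_scheduler_instance [OF I k refl refl]] show ?thesis by metis
  qed
  then show ?thesis by blast
qed

end
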